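(* The law $\mathcal{W}_0$ of the steady state cluster $\mathcal{C}$ is the unique solution (among laws of random finite rooted trees up to isomorphism) of the following recursive distributional equation: $\mathcal{C}$ is a singleton with probability $1/2$, and otherwise $\mathcal{C}$ is obtained by taking two independent rooted trees $\mathcal{C}'$ and $\mathcal{C}''$, each distributed according to the law of $\mathcal{C}$, joining their roots by an edge, and then selecting the root of $\mathcal{C}$ uniformly at random among the vertices of the resulting tree.
   Context: The law $\mathcal{W}_0$ of the steady state cluster $\mathcal{C}$ is defined as follows. For a probability law $\mathcal{W}$ on isomorphism classes of finite rooted simple graphs, let $\mathcal{C}_1^{\mathcal W}(t)$ be the process started from a single root vertex $\rho$ which, when it has $k$ vertices, waits an independent exponential time of rate $k$ and then attaches an independent $\mathcal{W}$-distributed rooted graph $(C,r)$ by adding an edge from $r$ to a uniformly random vertex of the current graph, the root remaining $\rho$; let $t_\infty$ be the limit of the jump times. If $\mathbb{E}(t_\infty)<\infty$, let $\mathcal{C}^{\mathcal W}(t)$, $t\in\mathbb{R}$, be the stationary process obtained by concatenating independent copies of $\mathcal{C}_1^{\mathcal W}$ on consecutive time intervals (returning to the singleton at each explosion), the copy whose interval contains $0$ being size-biased by its lifetime, with $0$ placed uniformly in that interval. $\mathcal{W}_0$ is the unique law $\mathcal{W}$ such that $\mathcal{C}_1^{\mathcal W}$ explodes almost surely and $\mathcal{C}^{\mathcal W}(0)$ has law $\mathcal{W}$; it is supported on finite rooted trees. *)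

theory Defs
  imports "HOL-Probability.Probability"
begin

section \<open>Finite rooted simple graphs up to isomorphism\<close>

datatype raw_rgraph = Raw (verts: "nat set") (edges: "nat set set") (root_vertex: nat)

definition wf_raw :: "raw_rgraph \<Rightarrow> bool" where
  "wf_raw G \<longleftrightarrow> finite (verts G) \<and> root_vertex G \<in> verts G \<and>
     (\<forall>e\<in>edges G. e \<subseteq> verts G \<and> card e = 2)"

definition raw_iso_map :: "(nat \<Rightarrow> nat) \<Rightarrow> raw_rgraph \<Rightarrow> raw_rgraph \<Rightarrow> bool" where
  "raw_iso_map f G H \<longleftrightarrow>
     bij_betw f (verts G) (verts H) \<and> f (root_vertex G) = root_vertex H \<and> edges H = (\<lambda>e. f ` e) ` edges G"

definition raw_iso :: "raw_rgraph \<Rightarrow> raw_rgraph \<Rightarrow> bool" where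
  "raw_iso G H \<longleftrightarrow> wf_raw G \<and> wf_raw H \<and> (\<exists>f. raw_iso_map f G H)"

lemma raw_iso_refl: "wf_raw G \<Longrightarrow> raw_iso G G"
  unfolding raw_iso_def raw_iso_map_def by (auto intro!: exI[of _ id])

lemma raw_iso_map_inv:
  assumes "wf_raw G" "raw_iso_map f G H"
  shows "raw_iso_map (inv_into (verts G) f) H G"
proof -
  let ?g = "inv_into (verts G) f"
  have bij: "bij_betw f (verts G) (verts H)" and rt: "f (root_vertex G) = root_vertex H"
    and ed: "edges H = (\<lambda>e. f ` e) ` edges G"
    using assms(2) by (auto simp: raw_iso_map_def)
  have inj: "inj_on f (verts G)" using bij by (rule bij_betw_imp_inj_on)
  have "?g ` f ` e = e" if "e \<in> edges G" for e
    using that assms(1) inj by (intro inv_into_image_cancel) (auto simp: wf_raw_def)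
  then have "edges G = (\<lambda>e. ?g ` e) ` edges H"
    unfolding ed image_image by simp
  moreover have "?g (root_vertex H) = root_vertex G"
    using rt inj assms(1) by (metis inv_into_f_f wf_raw_def)
  ultimately show ?thesis
    using bij_betw_inv_into[OF bij] by (simp add: raw_iso_map_def)
qed

lemma raw_iso_sym: "raw_iso G H \<Longrightarrow> raw_iso H G"
  unfolding raw_iso_def using raw_iso_map_inv by blast

lemma raw_iso_trans:
  assumes "raw_iso G H" "raw_iso H K" shows "raw_iso G K"
proof -
  obtain f g where "raw_iso_map f G H" "raw_iso_map g H K"
    using assms by (auto simp: raw_iso_def)
  then have "raw_iso_map (g \<circ> f) G K"
    by (auto simp: raw_iso_map_def image_image intro: bij_betw_trans)
  then show ?thesis using assms by (auto simp: raw_iso_def)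
qed

quotient_type rgraph = raw_rgraph / partial: raw_iso
proof (rule part_equivpI)
  have "wf_raw (Raw {0} {} 0)" by (simp add: wf_raw_def)
  then show "\<exists>G. raw_iso G G" using raw_iso_refl by blast
  show "symp raw_iso" by (auto intro: sympI raw_iso_sym)
  show "transp raw_iso" by (auto intro: transpI raw_iso_trans)
qed

lift_definition singleton_rgraph :: rgraph is "Raw {0} {} 0"
  by (rule raw_iso_refl) (simp add: wf_raw_def)

lift_definition num_verts :: "rgraph \<Rightarrow> nat" is "\<lambda>G. card (verts G)"
  by (auto simp: raw_iso_def raw_iso_map_def intro: bij_betw_same_card)

definition raw_connected :: "raw_rgraph \<Rightarrow> bool" where
  "raw_connected G \<longleftrightarrow> (\<forall>u\<in>verts G. \<forall>v\<in>verts G. (u, v) \<in> {(x, y). {x, y} \<in> edges G}\<^sup>*)"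

definition raw_cycle :: "raw_rgraph \<Rightarrow> nat list \<Rightarrow> bool" where
  "raw_cycle G xs \<longleftrightarrow> 3 \<le> length xs \<and> distinct xs \<and>
     (\<forall>i<length xs. {xs ! i, xs ! (Suc i mod length xs)} \<in> edges G)"

definition raw_tree :: "raw_rgraph \<Rightarrow> bool" where
  "raw_tree G \<longleftrightarrow> raw_connected G \<and> (\<nexists>xs. raw_cycle G xs)"

lemma raw_tree_iso:
  assumes "raw_iso G H" "raw_tree H" shows "raw_tree G"
proof -
  obtain f where wf: "wf_raw G" "wf_raw H" and f: "raw_iso_map f G H"
    using assms(1) by (auto simp: raw_iso_def)
  have bij: "bij_betw f (verts G) (verts H)" and ed: "edges H = (\<lambda>e. f ` e) ` edges G"
    using f by (auto simp: raw_iso_map_def)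
  define g where "g = inv_into (verts G) f"
  have g: "raw_iso_map g H G" unfolding g_def using wf(1) f by (rule raw_iso_map_inv)
  then have edg: "edges G = (\<lambda>e. g ` e) ` edges H" by (simp add: raw_iso_map_def)
  have inj: "inj_on f (verts G)" using bij by (rule bij_betw_imp_inj_on)
  have gstep: "{g x, g y} \<in> edges G" if "{x, y} \<in> edges H" for x y
    using imageI[OF that, of "\<lambda>e. g ` e"] by (simp add: edg)
  have fstep: "{f x, f y} \<in> edges H" if "{x, y} \<in> edges G" for x y
    using imageI[OF that, of "\<lambda>e. f ` e"] by (simp add: ed)
  have conn: "(g x, g y) \<in> {(x, y). {x, y} \<in> edges G}\<^sup>*"
    if "(x, y) \<in> {(x, y). {x, y} \<in> edges H}\<^sup>*" for x y
    using that
  proof induction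
    case (step y z)
    then show ?case using gstep by (auto intro: rtrancl_into_rtrancl)
  qed simp
  have "raw_connected G" unfolding raw_connected_def
  proof (intro ballI)
    fix u v assume uv: "u \<in> verts G" "v \<in> verts G"
    then have "(f u, f v) \<in> {(x, y). {x, y} \<in> edges H}\<^sup>*"
      using assms(2) bij_betwE[OF bij] unfolding raw_tree_def raw_connected_def by blast
    from conn[OF this] show "(u, v) \<in> {(x, y). {x, y} \<in> edges G}\<^sup>*"
      using uv inj by (simp add: g_def)
  qed
  moreover have "\<not> raw_cycle G xs" for xs
  proof
    assume c: "raw_cycle G xs"
    have "xs ! i \<in> verts G" if "i < length xs" for i
    proof -
      have "{xs ! i, xs ! (Suc i mod length xs)} \<in> edges G"
        using c that by (simp add: raw_cycle_def)
      moreover have "\<forall>e\<in>edges G. e \<subseteq> verts G" using wf(1) by (simp add: wf_raw_def)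
      ultimately have "{xs ! i, xs ! (Suc i mod length xs)} \<subseteq> verts G" by (rule bspec[rotated])
      then show ?thesis by simp
    qed
    then have sub: "set xs \<subseteq> verts G" by (auto simp: in_set_conv_nth)
    have "distinct (map f xs)"
      using c inj_on_subset[OF inj sub] by (simp add: raw_cycle_def distinct_map)
    moreover have "{map f xs ! i, map f xs ! (Suc i mod length xs)} \<in> edges H"
      if "i < length xs" for i
    proof -
      have "Suc i mod length xs < length xs" using that by (intro mod_less_divisor) linarith
      then show ?thesis using c that fstep by (simp add: raw_cycle_def)
    qed
    ultimately have "raw_cycle H (map f xs)" using c by (simp add: raw_cycle_def)
    then show False using assms(2) by (auto simp: raw_tree_def)
  qed
  ultimately show ?thesis by (simp add: raw_tree_def)
qed

lift_definition is_tree :: "rgraph \<Rightarrow> bool" is raw_tree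
  using raw_tree_iso raw_iso_sym by blast


section \<open>Joining and re-rooting\<close>

text \<open>\<open>raw_join v G H\<close> is the disjoint union of \<open>G\<close> (on the even numbers) and \<open>H\<close> (on the
  odd numbers) together with an edge from the vertex \<open>v\<close> of \<open>G\<close> to the root of \<open>H\<close>;
  its root is the root of \<open>G\<close>.\<close>

definition raw_join :: "nat \<Rightarrow> raw_rgraph \<Rightarrow> raw_rgraph \<Rightarrow> raw_rgraph" where
  "raw_join v G H =
     Raw ((\<lambda>x. 2 * x) ` verts G \<union> (\<lambda>x. 2 * x + 1) ` verts H)
       (insert {2 * v, 2 * root_vertex H + 1}
         ((\<lambda>e. (\<lambda>x. 2 * x) ` e) ` edges G \<union> (\<lambda>e. (\<lambda>x. 2 * x + 1) ` e) ` edges H))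
       (2 * root_vertex G)"

lemma wf_raw_join:
  assumes "wf_raw G" "wf_raw H" "v \<in> verts G"
  shows "wf_raw (raw_join v G H)"
proof -
  have "card ((\<lambda>x. 2 * x) ` e) = 2" if "e \<in> edges G" for e
    using that assms(1) by (subst card_image) (auto simp: wf_raw_def inj_on_def)
  moreover have "card ((\<lambda>x. 2 * x + 1) ` e) = 2" if "e \<in> edges H" for e
    using that assms(2) by (subst card_image) (auto simp: wf_raw_def inj_on_def)
  moreover have "card {2 * v, 2 * root_vertex H + 1} = 2"
    using double_not_eq_Suc_double by simp
  moreover have "(\<lambda>x. 2 * x) ` e \<subseteq> (\<lambda>x. 2 * x) ` verts G" if "e \<in> edges G" for e
    using that assms(1) by (intro image_mono) (auto simp: wf_raw_def)
  moreover have "(\<lambda>x. 2 * x + 1) ` e \<subseteq> (\<lambda>x. 2 * x + 1) ` verts H" if "e \<in> edges H" for e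
    using that assms(2) by (intro image_mono) (auto simp: wf_raw_def)
  moreover have "{2 * v, 2 * root_vertex H + 1} \<subseteq> (\<lambda>x. 2 * x) ` verts G \<union> (\<lambda>x. 2 * x + 1) ` verts H"
    using assms by (auto simp: wf_raw_def)
  moreover have "2 * root_vertex G \<in> (\<lambda>x. 2 * x) ` verts G"
    using assms(1) by (intro imageI) (simp add: wf_raw_def)
  moreover have "finite (verts G)" "finite (verts H)"
    using assms by (auto simp: wf_raw_def)
  ultimately show ?thesis
    unfolding raw_join_def wf_raw_def raw_rgraph.sel
    by blast
qed

lemma raw_iso_join:
  assumes "wf_raw G" "wf_raw G'" "raw_iso_map f G G'"
    and "wf_raw H" "wf_raw H'" "raw_iso_map g H H'" and v: "v \<in> verts G"
  shows "raw_iso (raw_join v G H) (raw_join (f v) G' H')"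
proof -
  define h where "h n = (if even n then 2 * f (n div 2) else 2 * g (n div 2) + 1)" for n
  have h0: "h (2 * x) = 2 * f x" and h1: "h (Suc (2 * x)) = Suc (2 * g x)" for x
    by (auto simp: h_def)
  have fb: "inj_on f (verts G)" "verts G' = f ` verts G" "root_vertex G' = f (root_vertex G)"
      "edges G' = (\<lambda>e. f ` e) ` edges G"
    using assms(3) by (auto simp: raw_iso_map_def bij_betw_def)
  have gb: "inj_on g (verts H)" "verts H' = g ` verts H" "root_vertex H' = g (root_vertex H)"
      "edges H' = (\<lambda>e. g ` e) ` edges H"
    using assms(6) by (auto simp: raw_iso_map_def bij_betw_def)
  have "inj_on h ((\<lambda>x. 2 * x) ` verts G \<union> (\<lambda>x. Suc (2 * x)) ` verts H)"
    unfolding inj_on_Un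
  proof (intro conjI)
    show "inj_on h ((\<lambda>x. 2 * x) ` verts G)" "inj_on h ((\<lambda>x. Suc (2 * x)) ` verts H)"
      using fb(1) gb(1) by (auto simp: inj_on_def h0 h1)
    have "h (2 * x) \<noteq> h (Suc (2 * y))" for x y unfolding h0 h1 by presburger
    then show "h ` ((\<lambda>x. 2 * x) ` verts G - (\<lambda>x. Suc (2 * x)) ` verts H) \<inter>
        h ` ((\<lambda>x. Suc (2 * x)) ` verts H - (\<lambda>x. 2 * x) ` verts G) = {}"
      by fast
  qed
  then have "inj_on h (verts (raw_join v G H))" by (simp add: raw_join_def)
  moreover have "h ` verts (raw_join v G H) = verts (raw_join (f v) G' H')"
    by (simp add: raw_join_def image_Un image_image h0 h1 fb(2) gb(2))
  moreover have "h (root_vertex (raw_join v G H)) = root_vertex (raw_join (f v) G' H')"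
    by (simp add: raw_join_def h0 fb(3))
  moreover have "edges (raw_join (f v) G' H') = (\<lambda>e. h ` e) ` edges (raw_join v G H)"
    by (simp add: raw_join_def image_Un image_image h0 h1 fb(4) gb(3,4))
  ultimately have "raw_iso_map h (raw_join v G H) (raw_join (f v) G' H')"
    by (simp add: raw_iso_map_def bij_betw_def)
  moreover have "f v \<in> verts G'" using v fb(2) by auto
  ultimately show ?thesis
    unfolding raw_iso_def using assms wf_raw_join by blast
qed

lift_definition join_roots :: "rgraph \<Rightarrow> rgraph \<Rightarrow> rgraph" is
  "\<lambda>G H. raw_join (root_vertex G) G H"
proof -
  fix G G' H H' assume "raw_iso G G'" "raw_iso H H'"
  then obtain f g where *: "wf_raw G" "wf_raw G'" "raw_iso_map f G G'"
      "wf_raw H" "wf_raw H'" "raw_iso_map g H H'"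
    by (auto simp: raw_iso_def)
  have "root_vertex G \<in> verts G" "f (root_vertex G) = root_vertex G'"
    using * by (auto simp: wf_raw_def raw_iso_map_def)
  with raw_iso_join[OF *] show "raw_iso (raw_join (root_vertex G) G H) (raw_join (root_vertex G') G' H')"
    by metis
qed

lemma map_pmf_of_verts_cong:
  assumes "wf_raw G" "raw_iso_map f G G'"
    and "\<And>v. v \<in> verts G \<Longrightarrow> F v = F' (f v)"
  shows "map_pmf F (pmf_of_set (verts G)) = map_pmf F' (pmf_of_set (verts G'))"
proof -
  have fin: "finite (verts G)" "verts G \<noteq> {}" using assms(1) by (auto simp: wf_raw_def)
  have "bij_betw f (verts G) (verts G')" using assms(2) by (simp add: raw_iso_map_def)
  then have "pmf_of_set (verts G') = map_pmf f (pmf_of_set (verts G))"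
    using fin by (simp add: map_pmf_of_set_bij_betw)
  then show ?thesis
    using fin assms(3) by (simp add: map_pmf_comp) (rule map_pmf_cong, simp_all add: set_pmf_of_set)
qed

text \<open>\<open>attach_uniform G H\<close>: add an edge from the root of \<open>H\<close> to a uniformly random vertex
  of \<open>G\<close>, keeping the root of \<open>G\<close>.\<close>

lift_definition attach_uniform :: "rgraph \<Rightarrow> rgraph \<Rightarrow> rgraph pmf" is
  "\<lambda>G H. map_pmf (\<lambda>v. abs_rgraph (raw_join v G H)) (pmf_of_set (verts G))"
proof -
  fix G G' H H' assume "raw_iso G G'" "raw_iso H H'"
  then obtain f g where *: "wf_raw G" "wf_raw G'" "raw_iso_map f G G'"
      "wf_raw H" "wf_raw H'" "raw_iso_map g H H'"
    by (auto simp: raw_iso_def)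
  show "map_pmf (\<lambda>v. abs_rgraph (raw_join v G H)) (pmf_of_set (verts G)) =
      map_pmf (\<lambda>v. abs_rgraph (raw_join v G' H')) (pmf_of_set (verts G'))"
    using *(1,3)
    by (rule map_pmf_of_verts_cong) (intro Quotient3_rel_abs[OF Quotient3_rgraph] raw_iso_join[OF *])
qed

lift_definition reroot_uniform :: "rgraph \<Rightarrow> rgraph pmf" is
  "\<lambda>G. map_pmf (\<lambda>v. abs_rgraph (Raw (verts G) (edges G) v)) (pmf_of_set (verts G))"
proof -
  fix G G' assume "raw_iso G G'"
  then obtain f where *: "wf_raw G" "wf_raw G'" "raw_iso_map f G G'"
    by (auto simp: raw_iso_def)
  have "raw_iso (Raw (verts G) (edges G) v) (Raw (verts G') (edges G') (f v))"
    if "v \<in> verts G" for v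
    unfolding raw_iso_def
  proof (intro conjI exI[of _ f])
    show "wf_raw (Raw (verts G) (edges G) v)" using * that by (auto simp: wf_raw_def)
    show "wf_raw (Raw (verts G') (edges G') (f v))"
      using * that by (auto simp: wf_raw_def raw_iso_map_def bij_betw_def)
    show "raw_iso_map f (Raw (verts G) (edges G) v) (Raw (verts G') (edges G') (f v))"
      using * by (simp add: raw_iso_map_def)
  qed
  then show "map_pmf (\<lambda>v. abs_rgraph (Raw (verts G) (edges G) v)) (pmf_of_set (verts G)) =
      map_pmf (\<lambda>v. abs_rgraph (Raw (verts G') (edges G') v)) (pmf_of_set (verts G'))"
    using *(1,3)
    by (intro map_pmf_of_verts_cong[where f = f]) (auto intro: Quotient3_rel_abs[OF Quotient3_rgraph])
qed


section \<open>The growth process started from a single vertex\<close>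

text \<open>The coordinates of the sample space are independent. Coordinate \<open>(n, G)\<close> holds the
  waiting time and the successor state that are used if the state after \<open>n\<close> jumps is \<open>G\<close>;
  all other coordinates with first index \<open>n\<close> are then ignored.\<close>

type_synonym growth_path = "nat \<times> rgraph \<Rightarrow> real \<times> rgraph"

definition attach_law :: "rgraph pmf \<Rightarrow> rgraph \<Rightarrow> rgraph pmf" where
  "attach_law W G = bind_pmf W (\<lambda>C. attach_uniform G C)"

definition growth_space :: "rgraph pmf \<Rightarrow> growth_path measure" where
  "growth_space W = PiM UNIV (\<lambda>(n, G).
     density lborel (exponential_density (real (num_verts G))) \<Otimes>\<^sub>M measure_pmf (attach_law W G))"

primrec jump_chain :: "growth_path \<Rightarrow> nat \<Rightarrow> rgraph" where
  "jump_chain \<omega> 0 = singleton_rgraph"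
| "jump_chain \<omega> (Suc n) = snd (\<omega> (n, jump_chain \<omega> n))"

definition waiting_time :: "growth_path \<Rightarrow> nat \<Rightarrow> real" where
  "waiting_time \<omega> n = fst (\<omega> (n, jump_chain \<omega> n))"

definition jump_time :: "growth_path \<Rightarrow> nat \<Rightarrow> ennreal" where
  "jump_time \<omega> n = (\<Sum>k<n. ennreal (waiting_time \<omega> k))"

definition explosion_time :: "growth_path \<Rightarrow> ennreal" where
  "explosion_time \<omega> = (SUP n. jump_time \<omega> n)"

text \<open>Only meaningful for \<open>0 \<le> t\<close> and \<open>ennreal t < explosion_time \<omega>\<close>.\<close>

definition growth_state :: "growth_path \<Rightarrow> real \<Rightarrow> rgraph" where
  "growth_state \<omega> t = jump_chain \<omega> (LEAST n. ennreal t < jump_time \<omega> (Suc n))"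


section \<open>The two-sided stationary process\<close>

text \<open>Used only when the explosion time has finite mean under \<open>growth_space W\<close>; it is then
  almost surely finite.\<close>

definition size_biased_growth_space :: "rgraph pmf \<Rightarrow> growth_path measure" where
  "size_biased_growth_space W =
     density (growth_space W)
       (\<lambda>\<omega>. explosion_time \<omega> / (\<integral>\<^sup>+ \<omega>'. explosion_time \<omega>' \<partial>growth_space W))"

definition stationary_space :: "rgraph pmf \<Rightarrow> ((int \<Rightarrow> growth_path) \<times> real) measure" where
  "stationary_space W =
     PiM UNIV (\<lambda>i. if i = 0 then size_biased_growth_space W else growth_space W)
       \<Otimes>\<^sub>M uniform_measure lborel {0..<1}"

definition lifetime :: "growth_path \<Rightarrow> real" where
  "lifetime \<omega> = enn2real (explosion_time \<omega>)"

text \<open>Copy \<open>i\<close> occupies the interval from \<open>copy_start x i\<close> to \<open>copy_start x (i + 1)\<close>. Time 0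
  sits in the interval of copy 0, a uniform fraction of the way through it.\<close>

definition copy_start :: "(int \<Rightarrow> growth_path) \<times> real \<Rightarrow> int \<Rightarrow> real" where
  "copy_start = (\<lambda>(\<omega>, u) i.
     - u * lifetime (\<omega> 0) +
     (if 0 \<le> i then \<Sum>j\<in>{0..<i}. lifetime (\<omega> j) else - (\<Sum>j\<in>{i..<0}. lifetime (\<omega> j))))"

definition stationary_process :: "real \<Rightarrow> (int \<Rightarrow> growth_path) \<times> real \<Rightarrow> rgraph" where
  "stationary_process t x =
     (let i = (THE i. copy_start x i \<le> t \<and> t < copy_start x (i + 1))
      in growth_state (fst x i) (t - copy_start x i))"


section \<open>The law of the steady state cluster\<close>

definition is_steady_state_law :: "rgraph pmf \<Rightarrow> bool" where
  "is_steady_state_law W \<longleftrightarrow>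
     (AE \<omega> in growth_space W. explosion_time \<omega> < \<infinity>) \<and>
     (\<integral>\<^sup>+ \<omega>. explosion_time \<omega> \<partial>growth_space W) < \<infinity> \<and>
     distr (stationary_space W) (count_space UNIV) (stationary_process 0) = measure_pmf W"

definition steady_state_law :: "rgraph pmf" where
  "steady_state_law = (THE W. is_steady_state_law W)"

definition is_tree_law :: "rgraph pmf \<Rightarrow> bool" where
  "is_tree_law W \<longleftrightarrow> (\<forall>G\<in>set_pmf W. is_tree G)"

definition satisfies_rde :: "rgraph pmf \<Rightarrow> bool" where
  "satisfies_rde W \<longleftrightarrow>
     W = do {
       b \<leftarrow> bernoulli_pmf (1 / 2);
       if b then return_pmf singleton_rgraph
       else do {
         C' \<leftarrow> W;
         C'' \<leftarrow> W;
         reroot_uniform (join_roots C' C'')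
       }
     }"

end

theory Submission
  imports Defs
begin

text \<open>Both descriptions of the law, as a steady state and by the recursive equation, are equivalent
  to one balance equation. Write \<open>|G|\<close> for the number of vertices of \<open>G\<close>, \<open>o\<close> for the singleton
  and \<open>A\<^sub>W(G, K)\<close> for the probability that attaching a \<open>W\<close>-distributed graph to a uniform vertex of
  \<open>G\<close> yields \<open>K\<close>. The balance equation (\<open>balanced\<close>) is

  \<open>|K| W(K) = 1/2 [K = o] + (\<Sum>G. |G| W(G) A\<^sub>W(G, K))\<close>.

  It has at most one solution, because the right-hand side only involves graphs smaller than
  \<open>K\<close> (\<open>balanced_unique\<close>).

  Steady states. Let \<open>u(G)\<close> be the probability that the jump chain of the growth process visits
  \<open>G\<close>. A visit lasts for a mean time \<open>1 / |G|\<close>, so the mean lifetime is \<open>Z = (\<Sum>G. u(G) / |G|)\<close>, and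
  by size-biasing the stationary process is in state \<open>G\<close> at time 0 with probability
  \<open>u(G) / (|G| Z)\<close> (\<open>stationary_law\<close>). If this is \<open>W(G)\<close>, the recursion
  \<open>u(K) = [K = o] + (\<Sum>G. u(G) A\<^sub>W(G, K))\<close> turns into the balance equation with \<open>1 / Z\<close> in place of
  \<open>1/2\<close>; summing it over \<open>K\<close> with weights \<open>1 / |K|\<close> and using the symmetry between the two
  graphs that are joined gives \<open>Z = 2\<close> (\<open>balanced_const\<close>). Conversely, the
  recursion determines \<open>u\<close>, so for a solution of the balance equation \<open>u(K) = 2 |K| W(K)\<close>, whence
  \<open>Z = 2\<close> and \<open>W\<close> is a steady state.

  The recursive equation. A solution \<open>W\<close> is invariant under choosing a new uniform root.
  Multiplied by \<open>|K|\<close>, the equation counts pairs of graphs with joined roots and a marked vertex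
  in one of them; by symmetry the marked vertex may be put into the first graph, which cancels
  the factor \<open>1/2\<close>. By the invariance, the old root and the marked vertex of the first graph may
  exchange roles, which gives the balance equation (\<open>rde_imp_balanced\<close>).

  It remains to construct one solution of the recursive equation that is supported on trees.
  Running the equation as a recursive random program yields a subprobability law whose mass \<open>w\<close>
  satisfies \<open>w = 1/2 + w\<^sup>2 / 2\<close>, so \<open>w = 1\<close> (\<open>rde_solution_exists\<close>). Its support consists of
  trees, because joining two trees by an edge gives a tree (\<open>raw_tree_join\<close>). This law solves
  the balance equation, hence is the only steady state and the only solution of the recursive
  equation.\<close>

section \<open>Sizes and rerooting of rooted graphs\<close>

lemma rgraph_cases:
  obtains A where "wf_raw A" "K = abs_rgraph A"
  using Quotient3_abs_rep[OF Quotient3_rgraph] Quotient3_rep_reflp[OF Quotient3_rgraph]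
  by (metis raw_iso_def)

text \<open>Finite graphs on natural numbers are finite data. Countability makes a coordinate that is
  evaluated at the random current state measurable, and it allows sums over all graphs to be exchanged
  with integrals.\<close>

lemma countable_rgraph: "countable (UNIV :: rgraph set)"
proof -
  let ?S = "{V :: nat set. finite V} \<times> {E :: nat set set. E \<subseteq> {V. finite V} \<and> finite E} \<times> (UNIV :: nat set)"
  have "countable ?S"
    using countable_Collect_finite_subset[OF countable_Collect_finite]
    by (intro countable_SIGMA countable_Collect_finite) (simp_all add: conj_commute)
  then have cnt: "countable (abs_rgraph ` (\<lambda>(V, E, r). Raw V E r) ` ?S)"
    by (intro countable_image)
  have "K \<in> abs_rgraph ` (\<lambda>(V, E, r). Raw V E r) ` ?S" for K
  proof -
    obtain A where A: "wf_raw A" "K = abs_rgraph A" by (rule rgraph_cases)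
    have "edges A \<subseteq> Pow (verts A)" "finite (verts A)"
      using A(1) by (auto simp: wf_raw_def)
    then have "(verts A, edges A, root_vertex A) \<in> ?S"
      by (auto intro: finite_subset)
    then have "A \<in> (\<lambda>(V, E, r). Raw V E r) ` ?S" by (rule image_eqI[rotated]) simp
    then show ?thesis unfolding A(2) by (rule imageI)
  qed
  then have "(UNIV :: rgraph set) \<subseteq> abs_rgraph ` (\<lambda>(V, E, r). Raw V E r) ` ?S" by blast
  then show ?thesis using cnt by (rule countable_subset)
qed

instance rgraph :: countable
  by standard (use countable_rgraph in \<open>simp add: countable_def\<close>)

lemma num_verts_abs: "wf_raw A \<Longrightarrow> num_verts (abs_rgraph A) = card (verts A)"
  by (simp add: num_verts.abs_eq raw_iso_refl)

lemma num_verts_pos: "0 < num_verts K"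
  by (rule rgraph_cases[of K]) (auto simp: num_verts_abs wf_raw_def card_gt_0_iff)

lemma num_verts_singleton: "num_verts singleton_rgraph = 1"
  by transfer simp

abbreviation raw_reroot :: "raw_rgraph \<Rightarrow> nat \<Rightarrow> raw_rgraph" where
  "raw_reroot A v \<equiv> Raw (verts A) (edges A) v"

lemma wf_raw_reroot: "wf_raw A \<Longrightarrow> v \<in> verts A \<Longrightarrow> wf_raw (raw_reroot A v)"
  by (simp add: wf_raw_def)

lemma wf_raw_finite: "wf_raw A \<Longrightarrow> finite (verts A)"
  and wf_raw_nonempty: "wf_raw A \<Longrightarrow> verts A \<noteq> {}"
  and wf_raw_root: "wf_raw A \<Longrightarrow> root_vertex A \<in> verts A"
  by (auto simp: wf_raw_def)

lemma set_pmf_of_verts: "wf_raw A \<Longrightarrow> set_pmf (pmf_of_set (verts A)) = verts A"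
  by (simp add: wf_raw_finite wf_raw_nonempty)

lemma verts_raw_join:
  "verts (raw_join v A B) = (\<lambda>x. 2 * x) ` verts A \<union> (\<lambda>x. 2 * x + 1) ` verts B"
  by (simp add: raw_join_def)

lemma card_verts_raw_join:
  assumes "wf_raw A" "wf_raw B"
  shows "card (verts (raw_join v A B)) = card (verts A) + card (verts B)"
proof -
  have "(\<lambda>x. 2 * x) ` verts A \<inter> (\<lambda>x. 2 * x + 1) ` verts B = {}"
    by (auto, presburger)
  then show ?thesis
    using assms by (simp add: verts_raw_join card_Un_disjoint wf_raw_finite card_image inj_on_def)
qed

lemma num_verts_join_roots: "num_verts (join_roots G H) = num_verts G + num_verts H"
proof -
  obtain A B where "wf_raw A" "G = abs_rgraph A" "wf_raw B" "H = abs_rgraph B"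
    by (metis rgraph_cases)
  then show ?thesis
    by (simp add: join_roots.abs_eq raw_iso_refl num_verts_abs wf_raw_join wf_raw_root card_verts_raw_join)
qed

lemma num_verts_attach_uniform:
  assumes "K \<in> set_pmf (attach_uniform G H)"
  shows "num_verts K = num_verts G + num_verts H"
proof -
  obtain A B where "wf_raw A" "G = abs_rgraph A" "wf_raw B" "H = abs_rgraph B"
    by (metis rgraph_cases)
  then show ?thesis using assms
    by (auto simp: attach_uniform.abs_eq raw_iso_refl num_verts_abs wf_raw_join wf_raw_root
        card_verts_raw_join set_pmf_of_verts)
qed

lemma num_verts_reroot_uniform:
  assumes "K \<in> set_pmf (reroot_uniform G)"
  shows "num_verts K = num_verts G"
proof -
  obtain A where "wf_raw A" "G = abs_rgraph A" by (rule rgraph_cases)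
  then show ?thesis using assms
    by (auto simp: reroot_uniform.abs_eq raw_iso_refl num_verts_abs wf_raw_reroot set_pmf_of_verts)
qed

lemma reroot_uniform_singleton: "reroot_uniform singleton_rgraph = return_pmf singleton_rgraph"
  unfolding singleton_rgraph_def
  by (subst reroot_uniform.abs_eq) (auto simp: raw_iso_refl wf_raw_def pmf_of_set_singleton)

lemma reroot_uniform_idem: "bind_pmf (reroot_uniform G) reroot_uniform = reroot_uniform G"
proof -
  obtain A where A: "wf_raw A" "G = abs_rgraph A" by (rule rgraph_cases)
  let ?U = "pmf_of_set (verts A)"
  have "bind_pmf (reroot_uniform G) reroot_uniform
      = bind_pmf ?U (\<lambda>v. reroot_uniform (abs_rgraph (raw_reroot A v)))"
    using A by (simp add: reroot_uniform.abs_eq raw_iso_refl bind_map_pmf)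
  also have "\<dots> = bind_pmf ?U (\<lambda>v. reroot_uniform G)"
    using A by (intro bind_pmf_cong refl)
      (simp add: reroot_uniform.abs_eq raw_iso_refl wf_raw_reroot set_pmf_of_verts)
  finally show ?thesis by simp
qed

text \<open>Join \<open>H\<close> to the root of \<open>G\<close> and then choose the root uniformly among the vertices of
  \<open>G\<close> only. This is the half of the recursive equation in which the new root falls into the
  first component. It differs from \<^const>\<open>attach_uniform\<close> in which end is random: there the root is
  kept and the attachment vertex is uniform, here the attachment vertex is the old root and the new
  root is uniform.\<close>

lift_definition reroot_first :: "rgraph \<Rightarrow> rgraph \<Rightarrow> rgraph pmf" is
  "\<lambda>A B. map_pmf (\<lambda>v. abs_rgraph (raw_join (root_vertex A) (raw_reroot A v) B)) (pmf_of_set (verts A))"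
proof -
  fix A A' B B' assume "raw_iso A A'" "raw_iso B B'"
  then obtain f g where *: "wf_raw A" "wf_raw A'" "raw_iso_map f A A'"
      "wf_raw B" "wf_raw B'" "raw_iso_map g B B'"
    by (auto simp: raw_iso_def)
  have "raw_iso (raw_join (root_vertex A) (raw_reroot A v) B)
      (raw_join (root_vertex A') (raw_reroot A' (f v)) B')" if v: "v \<in> verts A" for v
  proof -
    have "raw_iso_map f (raw_reroot A v) (raw_reroot A' (f v))"
      using * by (simp add: raw_iso_map_def)
    moreover have "f v \<in> verts A'" "f (root_vertex A) = root_vertex A'"
      using * v by (auto simp: raw_iso_map_def bij_betw_def)
    ultimately show ?thesis
      using raw_iso_join[of "raw_reroot A v" "raw_reroot A' (f v)" f B B' g "root_vertex A"] * v
      by (simp add: wf_raw_reroot wf_raw_root)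
  qed
  then show "map_pmf (\<lambda>v. abs_rgraph (raw_join (root_vertex A) (raw_reroot A v) B)) (pmf_of_set (verts A)) =
      map_pmf (\<lambda>v. abs_rgraph (raw_join (root_vertex A') (raw_reroot A' v) B')) (pmf_of_set (verts A'))"
    using *(1,3)
    by (intro map_pmf_of_verts_cong[where f = f]) (auto intro: Quotient3_rel_abs[OF Quotient3_rgraph])
qed

text \<open>Once the root of \<open>G\<close> has been resampled, root and attachment vertex are two independent uniform
  vertices, so exchanging their roles changes nothing. This is the mass transport argument
  behind the equivalence of the growth dynamics and the recursive equation.\<close>

lemma attach_uniform_reroot:
  "bind_pmf (reroot_uniform G) (\<lambda>G'. attach_uniform G' H)
     = bind_pmf (reroot_uniform G) (\<lambda>G'. reroot_first G' H)"
proof -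
  obtain A B where AB: "wf_raw A" "G = abs_rgraph A" "wf_raw B" "H = abs_rgraph B"
    by (metis rgraph_cases)
  let ?U = "pmf_of_set (verts A)"
  let ?J = "\<lambda>r v. abs_rgraph (raw_join v (raw_reroot A r) B)"
  have "bind_pmf (reroot_uniform G) (\<lambda>G'. attach_uniform G' H) = bind_pmf ?U (\<lambda>r. map_pmf (?J r) ?U)"
    using AB by (auto simp: reroot_uniform.abs_eq raw_iso_refl bind_map_pmf set_pmf_of_verts
        attach_uniform.abs_eq wf_raw_reroot intro!: bind_pmf_cong)
  also have "\<dots> = bind_pmf ?U (\<lambda>v. map_pmf (\<lambda>r. ?J r v) ?U)"
    unfolding map_pmf_def by (rule bind_commute_pmf)
  also have "\<dots> = bind_pmf (reroot_uniform G) (\<lambda>G'. reroot_first G' H)"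
    using AB by (auto simp: reroot_uniform.abs_eq raw_iso_refl bind_map_pmf set_pmf_of_verts
        reroot_first.abs_eq wf_raw_reroot intro!: bind_pmf_cong)
  finally show ?thesis .
qed

lemma pmf_map_uniform:
  assumes "finite V" "V \<noteq> {}"
  shows "real (card V) * pmf (map_pmf F (pmf_of_set V)) y = real (card {v \<in> V. F v = y})"
proof -
  have "V \<inter> F -` {y} = {v \<in> V. F v = y}" by auto
  then show ?thesis using assms by (simp add: pmf_map measure_pmf_of_set)
qed

text \<open>Joining two roots is symmetric up to the choice of the root. The isomorphism exchanges the even
  and the odd copy of the natural numbers.\<close>

lemma raw_iso_join_swap:
  assumes A: "wf_raw A" and B: "wf_raw B" and v: "v \<in> verts B"
  shows "raw_iso (raw_reroot (raw_join (root_vertex A) A B) (2 * v + 1))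
    (raw_join (root_vertex B) (raw_reroot B v) A)"
proof -
  define h :: "nat \<Rightarrow> nat" where "h n = (if even n then n + 1 else n - 1)" for n
  have h0: "h (2 * x) = Suc (2 * x)" and h1: "h (Suc (2 * x)) = 2 * x" for x
    by (auto simp: h_def)
  have "inj h"
    by (rule inj_on_inverseI[of _ h]) (auto simp: h_def)
  then have "raw_iso_map h (raw_reroot (raw_join (root_vertex A) A B) (2 * v + 1))
      (raw_join (root_vertex B) (raw_reroot B v) A)"
    unfolding raw_iso_map_def bij_betw_def
    by (auto simp: raw_join_def image_Un image_image h0 h1 insert_commute intro: inj_on_subset)
  moreover have "wf_raw (raw_reroot (raw_join (root_vertex A) A B) (2 * v + 1))"
    using assms by (intro wf_raw_reroot wf_raw_join wf_raw_root) (auto simp: verts_raw_join)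
  moreover have "wf_raw (raw_join (root_vertex B) (raw_reroot B v) A)"
    using assms by (intro wf_raw_join wf_raw_reroot) (auto simp: wf_raw_root)
  ultimately show ?thesis by (auto simp: raw_iso_def)
qed

text \<open>A uniform vertex of the joined graph lies in one of the two components, and a root in the
  second component looks like a root in the first one after exchanging the components. Both sides
  count vertices, the probabilities being multiplied by the sizes.\<close>

lemma pmf_reroot_join_roots:
  "real (num_verts G + num_verts H) * pmf (reroot_uniform (join_roots G H)) K
    = num_verts G * pmf (reroot_first G H) K + num_verts H * pmf (reroot_first H G) K"
proof -
  obtain A B where AB: "wf_raw A" "G = abs_rgraph A" "wf_raw B" "H = abs_rgraph B"
    by (metis rgraph_cases)
  let ?J = "raw_join (root_vertex A) A B"
  have J: "wf_raw ?J" using AB by (simp add: wf_raw_join wf_raw_root)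
  let ?F = "\<lambda>v. abs_rgraph (raw_reroot ?J v)"
  let ?S = "\<lambda>V. {v \<in> V. ?F v = K}"
  have "real (num_verts G + num_verts H) * pmf (reroot_uniform (join_roots G H)) K = real (card (?S (verts ?J)))"
    using AB J pmf_map_uniform[of "verts ?J" ?F K]
    by (simp add: join_roots.abs_eq reroot_uniform.abs_eq raw_iso_refl num_verts_abs wf_raw_finite
        wf_raw_nonempty card_verts_raw_join)
  also have "?S (verts ?J) = ?S ((\<lambda>x. 2 * x) ` verts A) \<union> ?S ((\<lambda>x. 2 * x + 1) ` verts B)"
    by (auto simp: verts_raw_join)
  also have "card \<dots> = card (?S ((\<lambda>x. 2 * x) ` verts A)) + card (?S ((\<lambda>x. 2 * x + 1) ` verts B))"
  proof (rule card_Un_disjoint)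
    show "?S ((\<lambda>x. 2 * x) ` verts A) \<inter> ?S ((\<lambda>x. 2 * x + 1) ` verts B) = {}"
      by (auto, presburger)
  qed (use AB in \<open>auto simp: wf_raw_finite\<close>)
  also have "?S ((\<lambda>x. 2 * x) ` verts A)
      = (\<lambda>x. 2 * x) ` {v \<in> verts A. abs_rgraph (raw_join (root_vertex A) (raw_reroot A v) B) = K}"
    by (auto simp: raw_join_def)
  also have "card \<dots> = card {v \<in> verts A. abs_rgraph (raw_join (root_vertex A) (raw_reroot A v) B) = K}"
    by (intro card_image) (auto simp: inj_on_def)
  also have "?S ((\<lambda>x. 2 * x + 1) ` verts B)
      = (\<lambda>x. 2 * x + 1) ` {v \<in> verts B. abs_rgraph (raw_join (root_vertex B) (raw_reroot B v) A) = K}"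
    using Quotient3_rel_abs[OF Quotient3_rgraph raw_iso_join_swap[OF AB(1,3)]] by auto
  also have "card \<dots> = card {v \<in> verts B. abs_rgraph (raw_join (root_vertex B) (raw_reroot B v) A) = K}"
    by (intro card_image) (auto simp: inj_on_def)
  finally show ?thesis
    using AB by (simp add: reroot_first.abs_eq raw_iso_refl num_verts_abs wf_raw_finite
        wf_raw_nonempty pmf_map_uniform)
qed

section \<open>Joining trees\<close>

lemma is_tree_abs: "wf_raw A \<Longrightarrow> is_tree (abs_rgraph A) = raw_tree A"
  by (simp add: is_tree.abs_eq raw_iso_refl)

lemma is_tree_singleton: "is_tree singleton_rgraph"
  by transfer (auto simp: raw_tree_def raw_connected_def raw_cycle_def intro!: exI[of _ "0 :: nat"])

lemma is_tree_reroot_uniform: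
  assumes "is_tree G" "K \<in> set_pmf (reroot_uniform G)"
  shows "is_tree K"
proof -
  obtain A where A: "wf_raw A" "G = abs_rgraph A" by (rule rgraph_cases)
  have "raw_tree (raw_reroot A v) = raw_tree A" for v
    by (simp add: raw_tree_def raw_connected_def raw_cycle_def)
  then show ?thesis using assms A
    by (auto simp: reroot_uniform.abs_eq raw_iso_refl is_tree_abs wf_raw_reroot set_pmf_of_verts)
qed

text \<open>Going around a cyclic list from a position with \<open>P\<close> to one without, \<open>P\<close> must be lost in
  some step.\<close>

lemma cycle_exit:
  assumes n: "0 < n" and "i < n" "P (xs ! i)" and "j < n" "\<not> P (xs ! j)"
  shows "\<exists>k<n. P (xs ! k) \<and> \<not> P (xs ! (Suc k mod n))"
proof (rule ccontr)
  assume "\<not> ?thesis"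
  then have step: "P (xs ! (Suc k mod n))" if "k < n" "P (xs ! k)" for k
    using that by blast
  have "P (xs ! ((i + m) mod n))" for m
  proof (induction m)
    case 0 then show ?case using assms by simp
  next
    case (Suc m)
    then show ?case using step[of "(i + m) mod n"] n by (simp add: mod_Suc_eq)
  qed
  from this[of "n + j - i"] show False using assms by simp
qed

lemma raw_cycle_pullback:
  assumes c: "raw_cycle A xs" and inj: "inj f"
    and sub: "set xs \<subseteq> range f"
    and ed: "\<And>x y. {f x, f y} \<in> edges A \<Longrightarrow> {x, y} \<in> edges B"
  shows "\<exists>ys. raw_cycle B ys"
proof -
  obtain ys where ys: "xs = map f ys"
    using sub by (metis ex_map_conv subset_code(1) rangeE)
  have "{ys ! i, ys ! (Suc i mod length ys)} \<in> edges B" if "i < length ys" for i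
  proof -
    have "Suc i mod length ys < length ys" using that by (intro mod_less_divisor) linarith
    moreover have "{xs ! i, xs ! (Suc i mod length xs)} \<in> edges A"
      using c that unfolding raw_cycle_def ys length_map by blast
    ultimately show ?thesis using that by (intro ed) (simp add: ys)
  qed
  then have "raw_cycle B ys"
    using c by (simp add: raw_cycle_def ys distinct_map)
  then show ?thesis ..
qed

text \<open>A cycle of the joined graph that meets both sides crosses from the even to the odd side and back.
  Both crossings use the new edge, the only one between the sides. As a cycle repeats no vertex, the
  two crossings are consecutive in both directions, so it has length two. Hence a cycle stays
  on one side, where it is a cycle of one of the given trees.\<close>

lemma raw_tree_join:
  assumes A: "wf_raw A" "raw_tree A" and B: "wf_raw B" "raw_tree B" and v: "v \<in> verts A"
  shows "raw_tree (raw_join v A B)"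
proof -
  let ?J = "raw_join v A B"
  let ?w = "root_vertex B"
  let ?R = "{(x, y). {x, y} \<in> edges ?J}"
  have ed0: "{2 * x, 2 * y} \<in> edges ?J \<longleftrightarrow> {x, y} \<in> edges A" for x y
  proof
    assume "{2 * x, 2 * y} \<in> edges ?J"
    then consider "{2 * x, 2 * y} = {2 * v, 2 * ?w + 1}"
      | e where "e \<in> edges A" "{2 * x, 2 * y} = (\<lambda>x. 2 * x) ` e"
      | e where "e \<in> edges B" "{2 * x, 2 * y} = (\<lambda>x. 2 * x + 1) ` e"
      by (auto simp: raw_join_def)
    then show "{x, y} \<in> edges A"
    proof cases
      case 1 then show ?thesis by (auto simp: doubleton_eq_iff) presburger+
    next
      case 2
      have "(\<lambda>x. 2 * x) ` {x, y} = (\<lambda>x. 2 * x) ` e" using 2(2) by simp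
      then have "{x, y} = e" by (subst (asm) inj_image_eq_iff) (auto simp: inj_on_def)
      then show ?thesis using 2 by simp
    next
      case 3
      then have "2 * x \<in> (\<lambda>x. 2 * x + 1) ` e" by auto
      then show ?thesis by (auto) presburger
    qed
  next
    assume "{x, y} \<in> edges A"
    then show "{2 * x, 2 * y} \<in> edges ?J" 
      using imageI[of "{x, y}" "edges A" "\<lambda>e. (\<lambda>x. 2 * x) ` e"] by (auto simp: raw_join_def)
  qed
  have ed1: "{2 * x + 1, 2 * y + 1} \<in> edges ?J \<longleftrightarrow> {x, y} \<in> edges B" for x y
  proof
    assume "{2 * x + 1, 2 * y + 1} \<in> edges ?J"
    then consider "{2 * x + 1, 2 * y + 1} = {2 * v, 2 * ?w + 1}"
      | e where "e \<in> edges A" "{2 * x + 1, 2 * y + 1} = (\<lambda>x. 2 * x) ` e"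
      | e where "e \<in> edges B" "{2 * x + 1, 2 * y + 1} = (\<lambda>x. 2 * x + 1) ` e"
      by (auto simp: raw_join_def)
    then show "{x, y} \<in> edges B"
    proof cases
      case 1 then show ?thesis by (auto simp: doubleton_eq_iff) presburger+
    next
      case 3
      have "(\<lambda>x. 2 * x + 1) ` {x, y} = (\<lambda>x. 2 * x + 1) ` e" using 3(2) by simp
      then have "{x, y} = e" by (subst (asm) inj_image_eq_iff) (auto simp: inj_on_def)
      then show ?thesis using 3 by simp
    next
      case 2
      then have "2 * x + 1 \<in> (\<lambda>x. 2 * x) ` e" by auto
      then show ?thesis by (auto) presburger
    qed
  next
    assume "{x, y} \<in> edges B"
    then show "{2 * x + 1, 2 * y + 1} \<in> edges ?J" 
      using imageI[of "{x, y}" "edges B" "\<lambda>e. (\<lambda>x. 2 * x + 1) ` e"] by (auto simp: raw_join_def)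
  qed
  have bridge: "x = v \<and> y = ?w" if "{2 * x, 2 * y + 1} \<in> edges ?J" for x y
  proof -
    from that consider "{2 * x, 2 * y + 1} = {2 * v, 2 * ?w + 1}"
      | e where "{2 * x, 2 * y + 1} = (\<lambda>x. 2 * x) ` e"
      | e where "{2 * x, 2 * y + 1} = (\<lambda>x. 2 * x + 1) ` e"
      by (auto simp: raw_join_def)
    then show ?thesis
    proof cases
      case 1 then show ?thesis by (auto simp: doubleton_eq_iff) presburger+
    next
      case 2
      then have "2 * y + 1 \<in> (\<lambda>x. 2 * x) ` e" by auto
      then show ?thesis by auto presburger+
    next
      case 3
      then have "2 * x \<in> (\<lambda>x. 2 * x + 1) ` e" by auto
      then show ?thesis by auto presburger+
    qed
  qed
  have bridge': "a = 2 * v \<and> b = 2 * ?w + 1" if ab: "even a" "odd b" "{a, b} \<in> edges ?J" for a b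
  proof -
    obtain x y where "a = 2 * x" "b = 2 * y + 1" using ab(1,2) by (elim evenE oddE)
    then show ?thesis using bridge[of x y] ab(3) by simp
  qed
  have symR: "sym (?R\<^sup>*)"
    by (rule sym_rtrancl) (auto simp: sym_def insert_commute)
  have fromv: "(2 * v, z) \<in> ?R\<^sup>*" if z: "z \<in> verts ?J" for z
  proof -
    have lift: "(f x, f y) \<in> ?R\<^sup>*"
      if "(x, y) \<in> {(x, y). {x, y} \<in> edges C}\<^sup>*" "\<And>x y. {x, y} \<in> edges C \<Longrightarrow> {f x, f y} \<in> edges ?J"
      for f :: "nat \<Rightarrow> nat" and C x y
      using that(1)
    proof induction
      case (step y z)
      then show ?case using that(2) by (auto intro: rtrancl_into_rtrancl)
    qed simp
    from z consider x where "x \<in> verts A" "z = 2 * x" | y where "y \<in> verts B" "z = 2 * y + 1"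
      by (auto simp: verts_raw_join)
    then show ?thesis
    proof cases
      case 1
      then have "(v, x) \<in> {(x, y). {x, y} \<in> edges A}\<^sup>*"
        using A v unfolding raw_tree_def raw_connected_def by blast
      from lift[OF this, of "\<lambda>x. 2 * x"] show ?thesis using ed0 1 by simp
    next
      case 2
      then have "(?w, y) \<in> {(x, y). {x, y} \<in> edges B}\<^sup>*"
        using B wf_raw_root unfolding raw_tree_def raw_connected_def by blast
      from lift[OF this, of "\<lambda>x. 2 * x + 1"] have "(2 * ?w + 1, z) \<in> ?R\<^sup>*" using ed1 2 by simp
      moreover have "(2 * v, 2 * ?w + 1) \<in> ?R" by (simp add: raw_join_def)
      ultimately show ?thesis by (rule converse_rtrancl_into_rtrancl[rotated])
    qed
  qed
  have "raw_connected ?J"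
    unfolding raw_connected_def
  proof (intro ballI)
    fix x y assume "x \<in> verts ?J" "y \<in> verts ?J"
    then have "(x, 2 * v) \<in> ?R\<^sup>*" "(2 * v, y) \<in> ?R\<^sup>*"
      using fromv symD[OF symR] by auto
    then show "(x, y) \<in> ?R\<^sup>*" by (rule rtrancl_trans)
  qed
  moreover have "\<not> raw_cycle ?J xs" for xs
  proof
    assume c: "raw_cycle ?J xs"
    let ?n = "length xs"
    have n: "3 \<le> ?n" "distinct xs"
      and edge: "\<And>i. i < ?n \<Longrightarrow> {xs ! i, xs ! (Suc i mod ?n)} \<in> edges ?J"
      using c by (auto simp: raw_cycle_def)
    have n0: "0 < ?n" using n by linarith
    have "set xs \<subseteq> range (\<lambda>x. 2 * x) \<or> set xs \<subseteq> range (\<lambda>x. 2 * x + 1)"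
    proof (rule ccontr)
      assume "\<not> ?thesis"
      moreover have "range (\<lambda>x::nat. 2 * x) = {x. even x}" by (auto simp: dvd_def)
      moreover have "range (\<lambda>x::nat. 2 * x + 1) = {x. odd x}" by (auto elim!: oddE)
      ultimately have "\<exists>x\<in>set xs. odd x" "\<exists>x\<in>set xs. even x" by auto
      then obtain i j where ij: "i < ?n" "even (xs ! i)" "j < ?n" "odd (xs ! j)"
        by (auto simp: in_set_conv_nth)
      obtain k where k: "k < ?n" "even (xs ! k)" "odd (xs ! (Suc k mod ?n))"
        using cycle_exit[of ?n i even xs j] ij n0 by auto
      obtain l where l: "l < ?n" "odd (xs ! l)" "even (xs ! (Suc l mod ?n))"
        using cycle_exit[of ?n j odd xs i] ij n0 by auto
      have "xs ! k = 2 * v \<and> xs ! (Suc k mod ?n) = 2 * ?w + 1"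
        using k edge[of k] by (intro bridge')
      moreover have "xs ! (Suc l mod ?n) = 2 * v \<and> xs ! l = 2 * ?w + 1"
        using l edge[of l] by (intro bridge') (simp_all add: insert_commute)
      moreover have "Suc k mod ?n < ?n" "Suc l mod ?n < ?n"
        using n0 by simp_all
      \<comment> \<open>Positions are determined by vertices, so each crossing ends where the other one starts.\<close>
      ultimately have "k = Suc l mod ?n" "l = Suc k mod ?n"
        using n k l by (metis nth_eq_iff_index_eq)+
      moreover have "Suc m mod ?n = (if Suc m = ?n then 0 else Suc m)" if "m < ?n" for m
        using that by (simp add: mod_Suc)
      ultimately have "k = 0 \<and> Suc l = ?n \<or> k = Suc l" "l = 0 \<and> Suc k = ?n \<or> l = Suc k"
        using k(1) l(1) by metis+
      then show False using n(1) by arith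
    qed
    then show False
    proof
      assume "set xs \<subseteq> range (\<lambda>x. 2 * x)"
      then have "\<exists>ys. raw_cycle A ys"
        using ed0 by (intro raw_cycle_pullback[OF c]) (auto simp: inj_on_def)
      then show False using A by (simp add: raw_tree_def)
    next
      assume "set xs \<subseteq> range (\<lambda>x. 2 * x + 1)"
      then have "\<exists>ys. raw_cycle B ys"
        using ed1 by (intro raw_cycle_pullback[OF c, where f = "\<lambda>x. 2 * x + 1"]) (auto simp: inj_on_def)
      then show False using B by (simp add: raw_tree_def)
    qed
  qed
  ultimately show ?thesis by (simp add: raw_tree_def)
qed

lemma is_tree_join_roots:
  assumes "is_tree G" "is_tree H" shows "is_tree (join_roots G H)"
proof -
  obtain A B where "wf_raw A" "G = abs_rgraph A" "wf_raw B" "H = abs_rgraph B"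
    by (metis rgraph_cases)
  then show ?thesis using assms
    by (simp add: join_roots.abs_eq raw_iso_refl is_tree_abs wf_raw_join wf_raw_root raw_tree_join)
qed

section \<open>The balance equation\<close>

lemma nn_integral_pmf_swap:
  "(\<integral>\<^sup>+x. \<integral>\<^sup>+y. f x y \<partial>measure_pmf q \<partial>measure_pmf p) = (\<integral>\<^sup>+y. \<integral>\<^sup>+x. f x y \<partial>measure_pmf p \<partial>measure_pmf q)"
proof -
  have "(\<integral>\<^sup>+x. \<integral>\<^sup>+y. f x y \<partial>measure_pmf q \<partial>measure_pmf p) = (\<integral>\<^sup>+z. f (fst z) (snd z) \<partial>pair_pmf p q)"
    by (simp add: nn_integral_pair_pmf')
  also have "\<dots> = (\<integral>\<^sup>+z. f (snd z) (fst z) \<partial>pair_pmf q p)"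
    by (subst pair_commute_pmf) (simp add: case_prod_beta)
  finally show ?thesis by (simp add: nn_integral_pair_pmf')
qed

lemma ennreal_half: "ennreal (1 / 2) = 1 / 2"
  using divide_ennreal[of 1 2] by simp

lemma ennreal_half_times_2: "(1 / 2 * 2 :: ennreal) = 1"
proof -
  have "(1 / 2 * 2 :: ennreal) = ennreal (1 / 2) * ennreal 2"
    unfolding ennreal_half by simp
  also have "\<dots> = ennreal (1 / 2 * 2)"
    by (rule ennreal_mult[symmetric]) auto
  finally show ?thesis by simp
qed

definition esize :: "rgraph \<Rightarrow> ennreal" where
  "esize G = ennreal (real (num_verts G))"

lemma esize_nonzero: "esize G \<noteq> 0" and esize_finite: "esize G \<noteq> \<top>"
  using num_verts_pos[of G] by (simp_all add: esize_def)

lemma esize_divide_self: "esize G / esize G = 1"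
  by (rule ennreal_divide_self) (simp_all add: esize_nonzero esize_finite top.not_eq_extremum[symmetric])

lemma esize_singleton: "esize singleton_rgraph = 1"
  by (simp add: esize_def num_verts_singleton)

lemma esize_attach_uniform:
  "K \<in> set_pmf (attach_uniform G H) \<Longrightarrow> esize K = esize G + esize H"
  by (simp add: esize_def num_verts_attach_uniform ennreal_plus)

text \<open>The stationarity condition for the growth process with attachments from \<open>W\<close>. A state
  \<open>G\<close> is left at rate \<open>|G|\<close> and turns into a sample of \<^term>\<open>attach_law W G\<close>. The singleton is
  moreover fed by the restarts, and \<open>c\<close> is their frequency, the inverse of the mean lifetime.\<close>

definition balanced :: "ennreal \<Rightarrow> rgraph pmf \<Rightarrow> bool" where
  "balanced c W \<longleftrightarrow> (\<forall>K. esize K * pmf W K =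
     c * indicator {singleton_rgraph} K + (\<integral>\<^sup>+G. esize G * pmf (attach_law W G) K \<partial>measure_pmf W))"

lemma esize_attach_law_integral:
  "(\<integral>\<^sup>+G. esize G * pmf (attach_law W G) K \<partial>measure_pmf W)
    = (\<integral>\<^sup>+G. \<integral>\<^sup>+C. esize G * pmf (attach_uniform G C) K \<partial>measure_pmf W \<partial>measure_pmf W)"
  by (simp add: attach_law_def ennreal_pmf_bind nn_integral_cmult)

text \<open>Divide the balance equation by \<open>|K|\<close> and sum over \<open>K\<close>. As the graph obtained from \<open>G\<close> and
  \<open>C\<close> has \<open>|G| + |C|\<close> vertices, the sum on the right is the mean of \<open>|G| / (|G| + |C|)\<close> for
  independent \<open>G\<close> and \<open>C\<close> with law \<open>W\<close>. By symmetry this mean is \<open>1/2\<close>, and the restarts have to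
  supply the other half of the total mass.\<close>

lemma balanced_const:
  assumes "balanced c W"
  shows "c = 1 / 2"
proof -
  let ?r = "\<lambda>G C. esize G / (esize G + esize C)"
  let ?I = "\<integral>\<^sup>+G. \<integral>\<^sup>+C. ?r G C \<partial>measure_pmf W \<partial>measure_pmf W"
  have W: "ennreal (pmf W K) = c * indicator {singleton_rgraph} K +
      (\<integral>\<^sup>+G. esize G * pmf (attach_law W G) K / esize K \<partial>measure_pmf W)" for K
  proof -
    have "ennreal (pmf W K) = esize K * pmf W K / esize K"
      by (subst mult.commute) (simp add: ennreal_mult_divide_eq esize_nonzero esize_finite)
    also have "\<dots> = c * indicator {singleton_rgraph} K / esize K +
        (\<integral>\<^sup>+G. esize G * pmf (attach_law W G) K \<partial>measure_pmf W) / esize K"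
      using assms unfolding balanced_def by (simp add: add_divide_distrib_ennreal)
    also have "c * indicator {singleton_rgraph} K / esize K = c * indicator {singleton_rgraph} K"
      by (auto simp: indicator_def esize_singleton divide_ennreal_def)
    finally show ?thesis by (simp add: nn_integral_divide)
  qed
  have inner: "(\<integral>\<^sup>+K. esize G * pmf (attach_law W G) K / esize K \<partial>count_space UNIV)
      = (\<integral>\<^sup>+C. ?r G C \<partial>measure_pmf W)" for G
  proof -
    have "(\<integral>\<^sup>+K. esize G * pmf (attach_law W G) K / esize K \<partial>count_space UNIV)
        = (\<integral>\<^sup>+K. pmf (attach_law W G) K * (esize G / esize K) \<partial>count_space UNIV)"
      by (intro nn_integral_cong) (simp add: divide_ennreal_def mult_ac)
    also have "\<dots> = (\<integral>\<^sup>+K. esize G / esize K \<partial>measure_pmf (attach_law W G))"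
      by (simp add: nn_integral_measure_pmf)
    also have "\<dots> = (\<integral>\<^sup>+C. \<integral>\<^sup>+K. esize G / esize K \<partial>measure_pmf (attach_uniform G C) \<partial>measure_pmf W)"
      by (simp add: attach_law_def)
    also have "\<dots> = (\<integral>\<^sup>+C. \<integral>\<^sup>+K. ?r G C \<partial>measure_pmf (attach_uniform G C) \<partial>measure_pmf W)"
      by (intro nn_integral_cong nn_integral_cong_AE) (auto simp: AE_measure_pmf_iff esize_attach_uniform)
    finally show ?thesis by simp
  qed
  have "1 = (\<integral>\<^sup>+K. pmf W K \<partial>count_space UNIV)"
    by (simp add: nn_integral_pmf)
  also have "\<dots> = (\<integral>\<^sup>+K. c * indicator {singleton_rgraph} K \<partial>count_space UNIV) +
      (\<integral>\<^sup>+K. \<integral>\<^sup>+G. esize G * pmf (attach_law W G) K / esize K \<partial>measure_pmf W \<partial>count_space UNIV)"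
    unfolding W by (rule nn_integral_add) auto
  also have "(\<integral>\<^sup>+K. c * indicator {singleton_rgraph} K \<partial>count_space UNIV) = c"
    by (subst nn_integral_cmult_indicator) auto
  also have "(\<integral>\<^sup>+K. \<integral>\<^sup>+G. esize G * pmf (attach_law W G) K / esize K \<partial>measure_pmf W \<partial>count_space UNIV)
      = (\<integral>\<^sup>+G. \<integral>\<^sup>+K. esize G * pmf (attach_law W G) K / esize K \<partial>count_space UNIV \<partial>measure_pmf W)"
    by (intro nn_integral_count_space_nn_integral[symmetric]) auto
  also have "\<dots> = ?I" by (simp add: inner)
  finally have 1: "1 = c + ?I" .
  have one: "?r G C + ?r C G = 1" for G C
  proof -
    have "?r G C + ?r C G = (esize G + esize C) / (esize G + esize C)"
      by (simp only: add.commute[of "esize C" "esize G"] add_divide_distrib_ennreal)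
    also have "\<dots> = 1"
      by (rule ennreal_divide_self)
        (simp_all add: esize_nonzero esize_finite top.not_eq_extremum[symmetric])
    finally show ?thesis .
  qed
  have "?I + ?I = (\<integral>\<^sup>+G. \<integral>\<^sup>+C. ?r G C \<partial>measure_pmf W \<partial>measure_pmf W) +
      (\<integral>\<^sup>+G. \<integral>\<^sup>+C. ?r C G \<partial>measure_pmf W \<partial>measure_pmf W)"
    by (subst (2) nn_integral_pmf_swap) (rule refl)
  also have "\<dots> = (\<integral>\<^sup>+G. \<integral>\<^sup>+C. ?r G C + ?r C G \<partial>measure_pmf W \<partial>measure_pmf W)"
    by (simp add: nn_integral_add)
  also have "\<dots> = 1"
    by (simp add: one)
  finally have 2: "?I + ?I = 1" .
  obtain i where i: "0 \<le> i" "?I = ennreal i"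
    using 2 by (cases ?I) auto
  obtain d where d: "0 \<le> d" "c = ennreal d"
    using 1 by (cases c) auto
  have "i + i = 1" "d + i = 1"
    using 1 2 i d by (simp_all add: ennreal_plus[symmetric] del: ennreal_plus)
  then have "d = 1 / 2" by simp
  then show ?thesis unfolding d(2) by (simp only: ennreal_half)
qed

text \<open>The balance equation is a recursion over the size: only graphs \<open>G\<close> and \<open>C\<close> that are both
  smaller than \<open>K\<close> contribute to the mass of \<open>K\<close>.\<close>

lemma balanced_unique:
  assumes "balanced c V" "balanced c W"
  shows "V = W"
proof (rule pmf_eqI)
  fix K
  show "pmf V K = pmf W K"
  proof (induction "num_verts K" arbitrary: K rule: less_induct)
    case less
    have expand: "esize K * pmf U K = c * indicator {singleton_rgraph} K +
        (\<integral>\<^sup>+G. \<integral>\<^sup>+C. ennreal (pmf U G) * pmf U C * (esize G * pmf (attach_uniform G C) K)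
          \<partial>count_space UNIV \<partial>count_space UNIV)" if "balanced c U" for U
      using that unfolding balanced_def esize_attach_law_integral
      by (simp add: nn_integral_measure_pmf nn_integral_cmult[symmetric] mult_ac)
    have term_eq: "ennreal (pmf V G) * pmf V C * (esize G * pmf (attach_uniform G C) K) =
        ennreal (pmf W G) * pmf W C * (esize G * pmf (attach_uniform G C) K)" for G C
    proof (cases "K \<in> set_pmf (attach_uniform G C)")
      case True
      then have "num_verts G < num_verts K" "num_verts C < num_verts K"
        using num_verts_attach_uniform[OF True] num_verts_pos by auto
      then show ?thesis using less by simp
    next
      case False
      then show ?thesis by (simp add: set_pmf_iff)
    qed
    have "esize K * pmf V K = esize K * pmf W K"
      unfolding expand[OF assms(1)] expand[OF assms(2)] term_eq ..
    then show ?case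
      by (simp add: ennreal_mult_cancel_left esize_nonzero esize_finite)
  qed
qed

section \<open>Solutions of the recursive distributional equation\<close>

definition rde_join :: "rgraph pmf \<Rightarrow> rgraph pmf" where
  "rde_join W = bind_pmf W (\<lambda>C'. bind_pmf W (\<lambda>C''. reroot_uniform (join_roots C' C'')))"

lemma satisfies_rde_alt:
  "satisfies_rde W \<longleftrightarrow> W = bind_pmf (bernoulli_pmf (1 / 2))
     (\<lambda>b. if b then return_pmf singleton_rgraph else rde_join W)"
  by (simp only: satisfies_rde_def rde_join_def)

lemma rde_pmf:
  assumes "satisfies_rde W"
  shows "ennreal (pmf W K) = (1 / 2 :: ennreal) * indicator {singleton_rgraph} K + (1 / 2 :: ennreal) * ennreal (pmf (rde_join W) K)"
proof -
  have "ennreal (pmf W K) = pmf (bind_pmf (bernoulli_pmf (1 / 2))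
     (\<lambda>b. if b then return_pmf singleton_rgraph else rde_join W)) K"
    using assms by (simp add: satisfies_rde_alt)
  also have "\<dots> = pmf (return_pmf singleton_rgraph) K * ennreal (1 / 2) + pmf (rde_join W) K * ennreal (1 / 2)"
    by (subst ennreal_pmf_bind) (subst nn_integral_bernoulli_pmf, auto)
  also note ennreal_half
  also have "ennreal (pmf (return_pmf singleton_rgraph) K) = indicator {singleton_rgraph} K"
    by (auto simp: indicator_def)
  finally show ?thesis
    by (simp only: mult.commute)
qed

text \<open>Resampling a uniform root twice is the same as resampling it once, and both branches of the
  recursive equation end with a uniformly chosen root.\<close>

lemma rde_reroot_invariant:
  assumes "satisfies_rde W"
  shows "bind_pmf W reroot_uniform = W"
proof -
  have j: "bind_pmf (rde_join W) reroot_uniform = rde_join W"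
    by (simp add: rde_join_def bind_assoc_pmf reroot_uniform_idem)
  have W: "W = bind_pmf (bernoulli_pmf (1 / 2))
     (\<lambda>b. if b then return_pmf singleton_rgraph else rde_join W)"
    using assms by (simp add: satisfies_rde_alt)
  have "bind_pmf W reroot_uniform = bind_pmf (bind_pmf (bernoulli_pmf (1 / 2))
     (\<lambda>b. if b then return_pmf singleton_rgraph else rde_join W)) reroot_uniform"
    using W by (rule arg_cong)
  also have "\<dots> = bind_pmf (bernoulli_pmf (1 / 2))
     (\<lambda>b. if b then return_pmf singleton_rgraph else rde_join W)"
    unfolding bind_assoc_pmf
    by (intro bind_pmf_cong) (auto simp: bind_return_pmf reroot_uniform_singleton j)
  finally show ?thesis using W by simp
qed

text \<open>Rerooting keeps the size, so under a reroot invariant law the graph may be rerooted first, and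
  then the two operations agree.\<close>

lemma reroot_invariant_attach:
  assumes "bind_pmf W reroot_uniform = W"
  shows "(\<integral>\<^sup>+G. esize G * pmf (reroot_first G H) K \<partial>measure_pmf W)
    = (\<integral>\<^sup>+G. esize G * pmf (attach_uniform G H) K \<partial>measure_pmf W)"
proof -
  have eq: "(\<integral>\<^sup>+G. esize G * pmf (F G) K \<partial>measure_pmf W)
      = (\<integral>\<^sup>+G. esize G * pmf (bind_pmf (reroot_uniform G) F) K \<partial>measure_pmf W)" for F
  proof -
    have "(\<integral>\<^sup>+G. esize G * pmf (F G) K \<partial>measure_pmf W)
        = (\<integral>\<^sup>+G. esize G * pmf (F G) K \<partial>measure_pmf (bind_pmf W reroot_uniform))"
      by (simp only: assms)
    also have "\<dots> = (\<integral>\<^sup>+G. \<integral>\<^sup>+G'. esize G' * pmf (F G') K \<partial>measure_pmf (reroot_uniform G) \<partial>measure_pmf W)"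
      by simp
    also have "\<dots> = (\<integral>\<^sup>+G. \<integral>\<^sup>+G'. esize G * pmf (F G') K \<partial>measure_pmf (reroot_uniform G) \<partial>measure_pmf W)"
      by (intro nn_integral_cong nn_integral_cong_AE)
        (auto simp: AE_measure_pmf_iff esize_def num_verts_reroot_uniform)
    finally show ?thesis by (simp add: nn_integral_cmult ennreal_pmf_bind)
  qed
  show ?thesis
    unfolding eq[of "\<lambda>G. reroot_first G H"] eq[of "\<lambda>G. attach_uniform G H"] attach_uniform_reroot ..
qed

lemma esize_reroot_join_roots:
  "esize K * pmf (reroot_uniform (join_roots G H)) K
    = esize G * pmf (reroot_first G H) K + esize H * pmf (reroot_first H G) K"
proof -
  have "esize K * pmf (reroot_uniform (join_roots G H)) K
      = ennreal (real (num_verts G + num_verts H) * pmf (reroot_uniform (join_roots G H)) K)"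
  proof (cases "K \<in> set_pmf (reroot_uniform (join_roots G H))")
    case True
    then show ?thesis
      by (simp add: esize_def num_verts_reroot_uniform num_verts_join_roots ennreal_mult)
  qed (simp add: set_pmf_iff)
  also have "\<dots> = esize G * pmf (reroot_first G H) K + esize H * pmf (reroot_first H G) K"
    unfolding pmf_reroot_join_roots by (simp add: esize_def ennreal_mult)
  finally show ?thesis .
qed

text \<open>Multiply the recursive equation by \<open>|K|\<close>. The term in which the new root lies in the
  first component and the one in which it lies in the second are equal, as both components have
  the same law, so together they cancel the factor \<open>1/2\<close>. Reroot invariance then turns a uniform
  root into a uniform attachment vertex.\<close>

lemma rde_imp_balanced:
  assumes "satisfies_rde W"
  shows "balanced (1 / 2) W"
  unfolding balanced_def
proof
  fix K
  let ?A = "\<integral>\<^sup>+G. esize G * pmf (attach_law W G) K \<partial>measure_pmf W"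
  let ?F = "\<lambda>G H. esize G * pmf (reroot_first G H) K"
  have A: "(\<integral>\<^sup>+H. \<integral>\<^sup>+G. ?F G H \<partial>measure_pmf W \<partial>measure_pmf W) = ?A"
    unfolding esize_attach_law_integral reroot_invariant_attach[OF rde_reroot_invariant[OF assms]]
    by (rule nn_integral_pmf_swap)
  have "esize K * pmf (rde_join W) K
      = (\<integral>\<^sup>+G. \<integral>\<^sup>+H. ?F G H + ?F H G \<partial>measure_pmf W \<partial>measure_pmf W)"
    by (simp add: rde_join_def ennreal_pmf_bind nn_integral_cmult[symmetric] esize_reroot_join_roots)
  also have "\<dots> = (\<integral>\<^sup>+G. \<integral>\<^sup>+H. ?F G H \<partial>measure_pmf W \<partial>measure_pmf W)
      + (\<integral>\<^sup>+G. \<integral>\<^sup>+H. ?F H G \<partial>measure_pmf W \<partial>measure_pmf W)"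
    by (simp add: nn_integral_add)
  also have "\<dots> = ?A + ?A"
    by (subst nn_integral_pmf_swap) (simp only: A)
  finally have J: "esize K * pmf (rde_join W) K = ?A + ?A" .
  have "esize K * pmf W K = (1 / 2 :: ennreal) * (esize K * indicator {singleton_rgraph} K) + (1 / 2 :: ennreal) * (esize K * pmf (rde_join W) K)"
    unfolding rde_pmf[OF assms] by (simp add: distrib_left mult_ac)
  also have "esize K * indicator {singleton_rgraph} K = (indicator {singleton_rgraph} K :: ennreal)"
    by (auto simp: indicator_def esize_singleton)
  also have "(1 / 2 :: ennreal) * (esize K * pmf (rde_join W) K) = ?A"
  proof -
    have "(1 / 2 :: ennreal) * (?A + ?A) = (1 / 2 * 2) * ?A" by (simp only: mult_2[symmetric] mult.assoc)
    also have "(1 / 2 * 2 :: ennreal) = 1"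
      by (rule ennreal_half_times_2)
    finally show ?thesis unfolding J by simp
  qed
  finally show "esize K * pmf W K = 1 / 2 * indicator {singleton_rgraph} K + ?A" .
qed

text \<open>The random recursion of the equation, run as a program that may fail to terminate: its output
  law is a subprobability law, the least solution of the equation.\<close>

partial_function (spmf) rde_spmf :: "unit \<Rightarrow> rgraph spmf" where
  "rde_spmf u = bind_pmf (bernoulli_pmf (1 / 2)) (\<lambda>b. if b then return_spmf singleton_rgraph
     else bind_spmf (rde_spmf u) (\<lambda>C'. bind_spmf (rde_spmf u) (\<lambda>C''.
       spmf_of_pmf (reroot_uniform (join_roots C' C'')))))"

lemma weight_bind_spmf_const:
  assumes "\<And>x. weight_spmf (f x) = c"
  shows "weight_spmf (bind_spmf p f) = weight_spmf p * c"
  using assms by (simp add: weight_bind_spmf o_def)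

text \<open>The total mass \<open>w\<close> satisfies \<open>w = 1/2 + w\<^sup>2 / 2\<close>, which forces \<open>w = 1\<close>: the program is a
  critical binary branching process and terminates almost surely.\<close>

lemma weight_rde_spmf: "weight_spmf (rde_spmf u) = 1"
proof -
  let ?w = "weight_spmf (rde_spmf u)"
  let ?f = "\<lambda>b. if b then return_spmf singleton_rgraph
     else bind_spmf (rde_spmf u) (\<lambda>C'. bind_spmf (rde_spmf u) (\<lambda>C''.
       spmf_of_pmf (reroot_uniform (join_roots C' C''))))"
  have "?w = weight_spmf (bind_spmf (spmf_of_pmf (bernoulli_pmf (1 / 2))) ?f)"
    by (simp only: rde_spmf.simps[of u, symmetric] bind_spmf_of_pmf)
  also have "\<dots> = 1 / 2 * weight_spmf (?f True) + 1 / 2 * weight_spmf (?f False)"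
    unfolding weight_bind_spmf o_def measure_spmf_spmf_of_pmf
    by (subst integral_bernoulli_pmf) (simp_all only: mult.commute, simp_all)
  also have "weight_spmf (?f False) = ?w * (?w * 1)"
    unfolding if_False by (intro weight_bind_spmf_const weight_spmf_of_pmf)
  also have "weight_spmf (?f True) = 1"
    by (simp only: if_True spmf_of_pmf_return_pmf[symmetric] weight_spmf_of_pmf)
  finally have "(?w - 1)\<^sup>2 = 0" by (simp add: power2_eq_square algebra_simps)
  then show ?thesis by simp
qed

lemma rde_solution_exists: "\<exists>W. satisfies_rde W"
proof -
  have "lossless_spmf (rde_spmf ())"
    by (simp add: lossless_spmf_def weight_rde_spmf)
  then obtain W where W: "rde_spmf () = spmf_of_pmf W"
    by (auto simp: lossless_spmf_conv_spmf_of_pmf)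
  have "spmf_of_pmf W = spmf_of_pmf (bind_pmf (bernoulli_pmf (1 / 2))
      (\<lambda>b. if b then return_pmf singleton_rgraph else rde_join W))"
    unfolding W[symmetric] 
    by (subst rde_spmf.simps)
      (auto simp: W rde_join_def spmf_of_pmf_bind intro!: bind_pmf_cong)
  then have "W = bind_pmf (bernoulli_pmf (1 / 2))
      (\<lambda>b. if b then return_pmf singleton_rgraph else rde_join W)"
    by (intro pmf_eqI) (metis spmf_spmf_of_pmf)
  then show ?thesis unfolding satisfies_rde_alt by blast
qed

text \<open>Induction over the size: a graph of size greater than one that has positive mass arises from two
  smaller ones by joining and rerooting.\<close>

lemma rde_is_tree_law:
  assumes "satisfies_rde W"
  shows "is_tree_law W"
proof -
  have "is_tree K" if "K \<in> set_pmf W" for K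
    using that
  proof (induction "num_verts K" arbitrary: K rule: less_induct)
    case less
    have "set_pmf W = set_pmf (bind_pmf (bernoulli_pmf (1 / 2))
      (\<lambda>b. if b then return_pmf singleton_rgraph else rde_join W))"
      using assms unfolding satisfies_rde_alt by (rule arg_cong)
    then consider "K = singleton_rgraph" | "K \<in> set_pmf (rde_join W)"
      using less.prems by (auto split: if_splits)
    then show ?case
    proof cases
      case 1
      then show ?thesis by (simp add: is_tree_singleton)
    next
      case 2
      then obtain G H where GH: "G \<in> set_pmf W" "H \<in> set_pmf W" "K \<in> set_pmf (reroot_uniform (join_roots G H))"
        by (auto simp: rde_join_def)
      have "num_verts G < num_verts K" "num_verts H < num_verts K"
        using num_verts_reroot_uniform[OF GH(3)] num_verts_pos[of G] num_verts_pos[of H]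
        by (simp_all add: num_verts_join_roots)
      then show ?thesis
        using less.hyps GH is_tree_join_roots is_tree_reroot_uniform by blast
    qed
  qed
  then show ?thesis by (simp add: is_tree_law_def)
qed

section \<open>Measurability of the growth process and of the stationary process\<close>

text \<open>The common sigma algebra of the path spaces \<^term>\<open>growth_space W\<close> and of their size-biased
  versions. It serves to state measurability independently of \<open>W\<close>.\<close>

definition path_algebra :: "growth_path measure" where
  "path_algebra = PiM UNIV (\<lambda>_. borel \<Otimes>\<^sub>M count_space UNIV)"

definition coord_law :: "rgraph pmf \<Rightarrow> rgraph \<Rightarrow> (real \<times> rgraph) measure" where
  "coord_law W G =
     density lborel (exponential_density (real (num_verts G))) \<Otimes>\<^sub>M measure_pmf (attach_law W G)"

lemma growth_space_alt: "growth_space W = PiM UNIV (\<lambda>i. coord_law W (snd i))"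
  by (simp add: growth_space_def coord_law_def case_prod_unfold)

lemma sets_coord_law [measurable_cong]: "sets (coord_law W G) = sets (borel \<Otimes>\<^sub>M count_space UNIV)"
  unfolding coord_law_def by (intro sets_pair_measure_cong) auto

lemma sets_growth_space [measurable_cong]: "sets (growth_space W) = sets path_algebra"
  unfolding growth_space_alt path_algebra_def by (intro sets_PiM_cong sets_coord_law refl)

lemma sets_size_biased [measurable_cong]: "sets (size_biased_growth_space W) = sets path_algebra"
  by (simp add: size_biased_growth_space_def sets_growth_space)

lemma sets_stationary_space [measurable_cong]:
  "sets (stationary_space W) = sets (PiM UNIV (\<lambda>_. path_algebra) \<Otimes>\<^sub>M borel)"
  unfolding stationary_space_def
  by (intro sets_pair_measure_cong sets_PiM_cong refl) (auto simp: sets_size_biased sets_growth_space)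

lemma space_path_algebra [simp]: "space path_algebra = UNIV"
  by (simp add: path_algebra_def space_PiM space_pair_measure)

lemma space_growth_space [simp]: "space (growth_space W) = UNIV"
  using sets_eq_imp_space_eq[OF sets_growth_space] by simp

lemma measurable_coord: "(\<lambda>\<omega>. \<omega> i) \<in> path_algebra \<rightarrow>\<^sub>M borel \<Otimes>\<^sub>M count_space UNIV"
  unfolding path_algebra_def by (rule measurable_component_singleton) simp

lemma measurable_jump_chain [measurable]: "(\<lambda>\<omega>. jump_chain \<omega> n) \<in> path_algebra \<rightarrow>\<^sub>M count_space UNIV"
proof (induction n)
  case (Suc n)
  have "(\<lambda>\<omega>. snd (\<omega> (n, G))) \<in> path_algebra \<rightarrow>\<^sub>M count_space UNIV" for G
    by (rule measurable_compose[OF measurable_coord measurable_snd])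
  from measurable_compose_countable[of "\<lambda>G \<omega>. snd (\<omega> (n, G))", OF this Suc]
  show ?case by (simp only: jump_chain.simps)
qed simp

lemma measurable_waiting_time [measurable]: "(\<lambda>\<omega>. waiting_time \<omega> n) \<in> borel_measurable path_algebra"
proof -
  have "(\<lambda>\<omega>. fst (\<omega> (n, G))) \<in> borel_measurable path_algebra" for G
    by (rule measurable_compose[OF measurable_coord measurable_fst])
  from measurable_compose_countable[of "\<lambda>G \<omega>. fst (\<omega> (n, G))", OF this measurable_jump_chain]
  show ?thesis by (simp only: waiting_time_def)
qed

lemma measurable_jump_time [measurable]: "(\<lambda>\<omega>. jump_time \<omega> n) \<in> borel_measurable path_algebra"
  unfolding jump_time_def by measurable

lemma measurable_explosion_time [measurable]: "explosion_time \<in> borel_measurable path_algebra"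
  unfolding explosion_time_def[abs_def] by measurable

lemma measurable_lifetime [measurable]: "lifetime \<in> borel_measurable path_algebra"
  unfolding lifetime_def[abs_def] by measurable

lemma measurable_growth_state [measurable]:
  "(\<lambda>x. growth_state (fst x) (snd x)) \<in> path_algebra \<Otimes>\<^sub>M borel \<rightarrow>\<^sub>M count_space UNIV"
proof -
  have "(\<lambda>x. LEAST n. ennreal (snd x) < jump_time (fst x) (Suc n)) \<in> path_algebra \<Otimes>\<^sub>M borel \<rightarrow>\<^sub>M count_space UNIV"
    by measurable
  from measurable_compose_countable[of "\<lambda>n x. jump_chain (fst x) n", OF _ this]
  show ?thesis unfolding growth_state_def by measurable
qed

lemma copy_start_mono: "i \<le> j \<Longrightarrow> copy_start x i \<le> copy_start x j"
proof -
  assume "i \<le> j"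
  have l: "0 \<le> lifetime \<omega>" for \<omega> by (simp add: lifetime_def)
  obtain \<omega> u where x: "x = (\<omega>, u)" by (cases x)
  consider "0 \<le> i" | "i < 0" "0 \<le> j" | "j < 0" using \<open>i \<le> j\<close> by linarith
  then show ?thesis
  proof cases
    case 1
    then show ?thesis using \<open>i \<le> j\<close> by (auto simp: x copy_start_def l intro!: sum_mono2)
  next
    case 2
    have "- (\<Sum>j\<in>{i..<0}. lifetime (\<omega> j)) \<le> 0" "0 \<le> (\<Sum>j\<in>{0..<j}. lifetime (\<omega> j))"
      by (auto intro!: sum_nonneg simp: l)
    then show ?thesis using 2 by (simp add: x copy_start_def)
  next
    case 3
    then show ?thesis using \<open>i \<le> j\<close> by (auto simp: x copy_start_def l intro!: sum_mono2)
  qed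
qed

text \<open>Lifetimes are nonnegative on every path, so the intervals of the copies are always disjoint. This
  makes the stationary process measurable everywhere and not only up to a null set.\<close>

lemma copy_interval_unique:
  assumes "copy_start x i \<le> t" "t < copy_start x (i + 1)" "copy_start x j \<le> t" "t < copy_start x (j + 1)"
  shows "i = j"
proof (rule ccontr)
  assume "i \<noteq> j"
  then consider "i + 1 \<le> j" | "j + 1 \<le> i" by linarith
  then show False
    using assms copy_start_mono[of "i + 1" j x] copy_start_mono[of "j + 1" i x] by cases auto
qed

lemma measurable_copy_start [measurable]:
  "(\<lambda>x. copy_start x i) \<in> borel_measurable (PiM UNIV (\<lambda>_. path_algebra) \<Otimes>\<^sub>M borel)"
  unfolding copy_start_def case_prod_beta by measurable

lemma measurable_stationary_process:
  "stationary_process t \<in> PiM UNIV (\<lambda>_. path_algebra) \<Otimes>\<^sub>M borel \<rightarrow>\<^sub>M count_space UNIV"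
proof -
  let ?M = "PiM UNIV (\<lambda>_::int. path_algebra) \<Otimes>\<^sub>M (borel :: real measure)"
  have 1: "(\<lambda>x. THE i. copy_start x i \<le> t \<and> t < copy_start x (i + 1)) \<in> ?M \<rightarrow>\<^sub>M count_space UNIV"
    by (rule measurable_THE[where I = UNIV]) (auto dest: copy_interval_unique)
  have "(\<lambda>x. growth_state (fst x i) (t - copy_start x i)) \<in> ?M \<rightarrow>\<^sub>M count_space UNIV" for i
  proof -
    have "(\<lambda>x. (fst x i, t - copy_start x i)) \<in> ?M \<rightarrow>\<^sub>M path_algebra \<Otimes>\<^sub>M borel" by measurable
    from measurable_compose[OF this measurable_growth_state] show ?thesis by simp
  qed
  from measurable_compose_countable[of "\<lambda>i x. growth_state (fst x i) (t - copy_start x i)", OF this 1]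
  show ?thesis by (simp only: stationary_process_def[abs_def] Let_def)
qed

section \<open>The jump chain and its Green function\<close>

lemma prob_space_coord_law: "prob_space (coord_law W G)"
proof -
  interpret A: prob_space "density lborel (exponential_density (real (num_verts G)))"
    by (rule prob_space_exponential_density) (simp add: num_verts_pos)
  interpret P: pair_prob_space "density lborel (exponential_density (real (num_verts G)))" "measure_pmf (attach_law W G)" ..
  show ?thesis unfolding coord_law_def by unfold_locales
qed

lemma prob_space_growth_space: "prob_space (growth_space W)"
  unfolding growth_space_alt by (intro prob_space_PiM prob_space_coord_law)

lemma nn_integral_coord_law_fst:
  "(\<integral>\<^sup>+x. ennreal (fst x) \<partial>coord_law W G) = 1 / esize G"
proof -
  let ?l = "real (num_verts G)"
  have l: "0 < ?l" by (simp add: num_verts_pos)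
  have m: "(\<lambda>x. ennreal (fst x)) \<in> borel_measurable (coord_law W G)" by measurable
  have "(\<integral>\<^sup>+x. ennreal (fst x) \<partial>coord_law W G)
      = (\<integral>\<^sup>+t. \<integral>\<^sup>+y. ennreal t \<partial>measure_pmf (attach_law W G) \<partial>density lborel (exponential_density ?l))"
    unfolding coord_law_def
    by (subst measure_pmf.nn_integral_fst[symmetric]) (use m[unfolded coord_law_def] in simp_all)
  also have "\<dots> = (\<integral>\<^sup>+t. ennreal (exponential_density ?l t) * ennreal t \<partial>lborel)"
    by (simp add: nn_integral_density)
  also have "\<dots> = (\<integral>\<^sup>+t. ennreal (erlang_density 0 ?l t * t ^ 1) \<partial>lborel)"
  proof (intro nn_integral_cong)
    fix t :: real
    show "ennreal (exponential_density ?l t) * ennreal t = ennreal (erlang_density 0 ?l t * t ^ 1)"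
    proof (cases "0 \<le> t")
      case True
      then show ?thesis using l by (subst ennreal_mult) auto
    qed (simp add: erlang_density_def)
  qed
  also have "\<dots> = 1 / esize G"
    unfolding nn_integral_erlang_ith_moment[OF l] using l
    by (simp add: esize_def divide_ennreal[symmetric] flip: ennreal_1)
  finally show ?thesis .
qed

lemma nn_integral_coord_law_snd:
  "(\<integral>\<^sup>+x. indicator {K} (snd x) \<partial>coord_law W G) = pmf (attach_law W G) K"
proof -
  interpret A: prob_space "density lborel (exponential_density (real (num_verts G)))"
    by (rule prob_space_exponential_density) (simp add: num_verts_pos)
  have m: "(\<lambda>x. indicator {K} (snd x) :: ennreal) \<in> borel_measurable (coord_law W G)" by measurable
  have "(\<integral>\<^sup>+x. indicator {K} (snd x) \<partial>coord_law W G)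
      = (\<integral>\<^sup>+t. \<integral>\<^sup>+y. indicator {K} y \<partial>measure_pmf (attach_law W G)
          \<partial>density lborel (exponential_density (real (num_verts G))))"
    unfolding coord_law_def
    by (subst measure_pmf.nn_integral_fst[symmetric]) (use m[unfolded coord_law_def] in simp_all)
  also have "\<dots> = pmf (attach_law W G) K"
    using A.emeasure_space_1 by (simp add: emeasure_pmf_single)
  finally show ?thesis .
qed

text \<open>Replacing one coordinate of a product space by an independent copy preserves the law. This is the
  form of independence from which the Markov property is derived.\<close>

lemma nn_integral_resample:
  assumes f: "f \<in> borel_measurable path_algebra"
  shows "(\<integral>\<^sup>+\<omega>. f \<omega> \<partial>growth_space W)
    = (\<integral>\<^sup>+x. \<integral>\<^sup>+\<omega>. f (fun_upd \<omega> i x) \<partial>growth_space W \<partial>coord_law W (snd i))"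
proof -
  interpret P: prob_space "growth_space W" by (rule prob_space_growth_space)
  let ?C = "coord_law W (snd i)"
  let ?u = "\<lambda>(x, \<omega>). fun_upd \<omega> i x"
  have u: "?u \<in> ?C \<Otimes>\<^sub>M growth_space W \<rightarrow>\<^sub>M growth_space W"
    using measurable_compose[OF measurable_pair_swap' measurable_add_dim[of i UNIV "\<lambda>i. coord_law W (snd i)"]]
    by (simp add: growth_space_alt case_prod_beta)
  have fg: "f \<in> borel_measurable (growth_space W)" using f by measurable
  have "growth_space W = distr (?C \<Otimes>\<^sub>M growth_space W) (growth_space W) ?u"
    using distr_pair_PiM_eq_PiM[of UNIV "\<lambda>i. coord_law W (snd i)" i]
    by (simp add: growth_space_alt prob_space_coord_law)
  then have "(\<integral>\<^sup>+\<omega>. f \<omega> \<partial>growth_space W) = (\<integral>\<^sup>+\<omega>. f \<omega> \<partial>distr (?C \<Otimes>\<^sub>M growth_space W) (growth_space W) ?u)"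
    by (rule arg_cong)
  also have "\<dots> = (\<integral>\<^sup>+z. f (?u z) \<partial>(?C \<Otimes>\<^sub>M growth_space W))"
    by (rule nn_integral_distr[OF u]) (use fg in simp)
  also have "\<dots> = (\<integral>\<^sup>+x. \<integral>\<^sup>+\<omega>. f (fun_upd \<omega> i x) \<partial>growth_space W \<partial>?C)"
    using P.nn_integral_fst[OF measurable_compose[OF u fg]] by simp
  finally show ?thesis .
qed

lemma jump_chain_upd: "n \<le> m \<Longrightarrow> jump_chain (fun_upd \<omega> (m, G) x) n = jump_chain \<omega> n"
  by (induction n) auto

text \<open>The state after \<open>n\<close> jumps does not look at the coordinate \<open>(n, G)\<close>, so that coordinate may be
  resampled.\<close>

lemma growth_markov:
  assumes [measurable]: "h \<in> borel_measurable (borel \<Otimes>\<^sub>M count_space UNIV)"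
  shows "(\<integral>\<^sup>+\<omega>. indicator {G} (jump_chain \<omega> n) * h (\<omega> (n, G)) \<partial>growth_space W)
    = (\<integral>\<^sup>+\<omega>. indicator {G} (jump_chain \<omega> n) \<partial>growth_space W) * (\<integral>\<^sup>+x. h x \<partial>coord_law W G)"
proof -
  have [measurable]: "(\<lambda>\<omega>. h (\<omega> (n, G))) \<in> borel_measurable path_algebra"
    by (rule measurable_compose[OF measurable_coord assms])
  have "(\<integral>\<^sup>+\<omega>. indicator {G} (jump_chain \<omega> n) * h (\<omega> (n, G)) \<partial>growth_space W)
      = (\<integral>\<^sup>+x. \<integral>\<^sup>+\<omega>. indicator {G} (jump_chain \<omega> n) * h x \<partial>growth_space W \<partial>coord_law W G)"
    by (subst nn_integral_resample[of _ _ "(n, G)"]) (simp_all add: jump_chain_upd)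
  also have "\<dots> = (\<integral>\<^sup>+x. (\<integral>\<^sup>+\<omega>. indicator {G} (jump_chain \<omega> n) \<partial>growth_space W) * h x \<partial>coord_law W G)"
    by (intro nn_integral_cong nn_integral_multc) measurable
  also have "\<dots> = (\<integral>\<^sup>+\<omega>. indicator {G} (jump_chain \<omega> n) \<partial>growth_space W) * (\<integral>\<^sup>+x. h x \<partial>coord_law W G)"
    by (intro nn_integral_cmult) measurable
  finally show ?thesis .
qed

lemma nn_integral_at_state:
  fixes F :: "rgraph \<Rightarrow> ennreal"
  shows "(\<integral>\<^sup>+G. indicator {G} a * F G \<partial>count_space UNIV) = F a"
proof -
  have "(\<integral>\<^sup>+G. indicator {G} a * F G \<partial>count_space UNIV) = (\<integral>\<^sup>+G. F G * indicator {a} G \<partial>count_space UNIV)"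
    by (intro nn_integral_cong) (auto simp: indicator_def)
  then show ?thesis by simp
qed

primrec chain_law :: "rgraph pmf \<Rightarrow> nat \<Rightarrow> rgraph pmf" where
  "chain_law W 0 = return_pmf singleton_rgraph"
| "chain_law W (Suc n) = bind_pmf (chain_law W n) (attach_law W)"

lemma nn_integral_growth_step:
  assumes h [measurable]: "h \<in> borel_measurable (borel \<Otimes>\<^sub>M count_space UNIV)"
  shows "(\<integral>\<^sup>+\<omega>. h (\<omega> (n, jump_chain \<omega> n)) \<partial>growth_space W)
    = (\<integral>\<^sup>+G. (\<integral>\<^sup>+\<omega>. indicator {G} (jump_chain \<omega> n) \<partial>growth_space W) * (\<integral>\<^sup>+x. h x \<partial>coord_law W G) \<partial>count_space UNIV)"
proof -
  have [measurable]: "(\<lambda>\<omega>. h (\<omega> (n, G))) \<in> borel_measurable path_algebra" for G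
    by (rule measurable_compose[OF measurable_coord h])
  have "(\<integral>\<^sup>+\<omega>. h (\<omega> (n, jump_chain \<omega> n)) \<partial>growth_space W)
      = (\<integral>\<^sup>+\<omega>. \<integral>\<^sup>+G. indicator {G} (jump_chain \<omega> n) * h (\<omega> (n, G)) \<partial>count_space UNIV \<partial>growth_space W)"
    by (simp only: nn_integral_at_state)
  also have "\<dots> = (\<integral>\<^sup>+G. \<integral>\<^sup>+\<omega>. indicator {G} (jump_chain \<omega> n) * h (\<omega> (n, G)) \<partial>growth_space W \<partial>count_space UNIV)"
    by (rule nn_integral_count_space_nn_integral) measurable
  finally show ?thesis by (simp add: growth_markov)
qed

lemma jump_chain_law:
  "(\<integral>\<^sup>+\<omega>. indicator {K} (jump_chain \<omega> n) \<partial>growth_space W) = pmf (chain_law W n) K"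
proof (induction n arbitrary: K)
  case 0
  interpret P: prob_space "growth_space W" by (rule prob_space_growth_space)
  show ?case using P.emeasure_space_1 by (simp add: indicator_def)
next
  case (Suc n)
  have "(\<integral>\<^sup>+\<omega>. indicator {K} (jump_chain \<omega> (Suc n)) \<partial>growth_space W)
      = (\<integral>\<^sup>+G. ennreal (pmf (chain_law W n) G) * pmf (attach_law W G) K \<partial>count_space UNIV)"
    using nn_integral_growth_step[where h = "\<lambda>x. indicator {K} (snd x)" and n = n and W = W]
    by (simp add: nn_integral_coord_law_snd Suc)
  also have "\<dots> = (\<integral>\<^sup>+G. pmf (attach_law W G) K \<partial>measure_pmf (chain_law W n))"
    by (simp add: nn_integral_measure_pmf)
  finally show ?case by (simp add: ennreal_pmf_bind)
qed

text \<open>The Green function of the jump chain: the expected number of visits, which is the probability of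
  ever visiting \<open>G\<close>.\<close>

definition green :: "rgraph pmf \<Rightarrow> rgraph \<Rightarrow> ennreal" where
  "green W G = (\<Sum>n. ennreal (pmf (chain_law W n) G))"

lemma suminf_head_ennreal: "(\<Sum>n. f n) = f 0 + (\<Sum>n. f (Suc n))" for f :: "nat \<Rightarrow> ennreal"
  using suminf_offset[of f 1] by (simp add: add.commute)

text \<open>A visit either happens at time 0 or is preceded by a visit to another state.\<close>

lemma green_rec:
  "green W K = indicator {singleton_rgraph} K +
     (\<integral>\<^sup>+G. green W G * pmf (attach_law W G) K \<partial>count_space UNIV)"
proof -
  have "green W K = ennreal (pmf (chain_law W 0) K) + (\<Sum>n. ennreal (pmf (chain_law W (Suc n)) K))"
    unfolding green_def by (rule suminf_head_ennreal)
  also have "(\<Sum>n. ennreal (pmf (chain_law W (Suc n)) K))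
      = (\<Sum>n. \<integral>\<^sup>+G. ennreal (pmf (chain_law W n) G) * pmf (attach_law W G) K \<partial>count_space UNIV)"
    by (simp only: chain_law.simps ennreal_pmf_bind nn_integral_measure_pmf)
  also have "\<dots> = (\<integral>\<^sup>+G. (\<Sum>n. ennreal (pmf (chain_law W n) G) * pmf (attach_law W G) K) \<partial>count_space UNIV)"
    by (rule nn_integral_suminf[symmetric]) simp
  also have "\<dots> = (\<integral>\<^sup>+G. green W G * pmf (attach_law W G) K \<partial>count_space UNIV)"
    by (simp add: green_def)
  also have "ennreal (pmf (chain_law W 0) K) = indicator {singleton_rgraph} K"
    by (auto simp: indicator_def)
  finally show ?thesis .
qed

text \<open>The expected total time spent in \<open>G\<close>: every visit lasts for a time of mean \<open>1 / |G|\<close>,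
  independently of what happened before.\<close>

lemma nn_integral_sojourn:
  "(\<integral>\<^sup>+\<omega>. (\<Sum>n. indicator {G} (jump_chain \<omega> n) * ennreal (waiting_time \<omega> n)) \<partial>growth_space W)
    = green W G / esize G"
proof -
  have "(\<integral>\<^sup>+\<omega>. indicator {G} (jump_chain \<omega> n) * ennreal (waiting_time \<omega> n) \<partial>growth_space W)
      = ennreal (pmf (chain_law W n) G) / esize G" for n
  proof -
    have "(\<integral>\<^sup>+\<omega>. indicator {G} (jump_chain \<omega> n) * ennreal (waiting_time \<omega> n) \<partial>growth_space W)
        = (\<integral>\<^sup>+\<omega>. indicator {G} (jump_chain \<omega> n) * ennreal (fst (\<omega> (n, G))) \<partial>growth_space W)"
      by (intro nn_integral_cong) (auto simp: indicator_def waiting_time_def)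
    also have "\<dots> = pmf (chain_law W n) G * (1 / esize G)"
      using growth_markov[where h = "\<lambda>x. ennreal (fst x)" and G = G and n = n and W = W]
      by (simp add: nn_integral_coord_law_fst jump_chain_law)
    finally show ?thesis by (simp add: divide_ennreal_def)
  qed
  then show ?thesis
    by (subst nn_integral_suminf) (auto simp: green_def)
qed

lemma explosion_time_eq_suminf: "explosion_time \<omega> = (\<Sum>n. ennreal (waiting_time \<omega> n))"
  by (simp add: explosion_time_def jump_time_def suminf_eq_SUP)

text \<open>The lifetime is the sum over all states of the time spent there.\<close>

lemma nn_integral_explosion_time:
  "(\<integral>\<^sup>+\<omega>. explosion_time \<omega> \<partial>growth_space W) = (\<integral>\<^sup>+G. green W G / esize G \<partial>count_space UNIV)"
proof -
  have "(\<integral>\<^sup>+\<omega>. explosion_time \<omega> \<partial>growth_space W)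
     = (\<integral>\<^sup>+\<omega>. (\<Sum>n. \<integral>\<^sup>+G. indicator {G} (jump_chain \<omega> n) * ennreal (waiting_time \<omega> n) \<partial>count_space UNIV) \<partial>growth_space W)"
    by (simp only: explosion_time_eq_suminf nn_integral_at_state)
  also have "\<dots> = (\<integral>\<^sup>+\<omega>. \<integral>\<^sup>+G. (\<Sum>n. indicator {G} (jump_chain \<omega> n) * ennreal (waiting_time \<omega> n)) \<partial>count_space UNIV \<partial>growth_space W)"
    by (simp add: nn_integral_suminf)
  also have "\<dots> = (\<integral>\<^sup>+G. \<integral>\<^sup>+\<omega>. (\<Sum>n. indicator {G} (jump_chain \<omega> n) * ennreal (waiting_time \<omega> n)) \<partial>growth_space W \<partial>count_space UNIV)"
    by (rule nn_integral_count_space_nn_integral) measurable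
  finally show ?thesis by (simp add: nn_integral_sojourn)
qed

section \<open>The law of the stationary process at time 0\<close>

text \<open>Jump times as real numbers. Negative waiting times are cut off, as the coercion to extended
  nonnegative reals does, so that the comparison with \<^const>\<open>jump_time\<close> holds on every
  path.\<close>

definition real_jump_time :: "growth_path \<Rightarrow> nat \<Rightarrow> real" where
  "real_jump_time \<omega> n = (\<Sum>k<n. max 0 (waiting_time \<omega> k))"

lemma jump_time_real: "jump_time \<omega> n = ennreal (real_jump_time \<omega> n)"
proof -
  have "jump_time \<omega> n = (\<Sum>k<n. ennreal (max 0 (waiting_time \<omega> k)))"
    by (simp only: jump_time_def ennreal_max_0)
  then show ?thesis by (simp only: real_jump_time_def sum_ennreal max.cobounded1)
qed

lemma real_jump_time_mono: "m \<le> n \<Longrightarrow> real_jump_time \<omega> m \<le> real_jump_time \<omega> n"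
  unfolding real_jump_time_def by (rule sum_mono2) auto

lemma real_jump_time_nonneg: "0 \<le> real_jump_time \<omega> n"
  unfolding real_jump_time_def by (rule sum_nonneg) auto

definition occupation_set :: "growth_path \<Rightarrow> rgraph \<Rightarrow> real set" where
  "occupation_set \<omega> G = {t. 0 \<le> t \<and> ennreal t < explosion_time \<omega> \<and> growth_state \<omega> t = G}"

lemma before_explosion_iff:
  assumes "0 \<le> t"
  shows "ennreal t < explosion_time \<omega> \<longleftrightarrow> (\<exists>n. t < real_jump_time \<omega> (Suc n))"
proof -
  have "ennreal t < explosion_time \<omega> \<longleftrightarrow> (\<exists>n. t < real_jump_time \<omega> n)"
    using assms by (simp add: explosion_time_def less_SUP_iff jump_time_real ennreal_less_iff)
  also have "\<dots> \<longleftrightarrow> (\<exists>n. t < real_jump_time \<omega> (Suc n))"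
    using real_jump_time_mono[of _ "Suc _" \<omega>] by (meson le_SucI less_le_trans order_refl)
  finally show ?thesis .
qed

text \<open>At each time before the explosion exactly one of the intervals between consecutive jumps is
  active, and it carries the current state.\<close>

lemma indicator_occupation_set:
  "(indicator (occupation_set \<omega> G) t :: ennreal) =
    (\<Sum>n. indicator {G} (jump_chain \<omega> n) * indicator {real_jump_time \<omega> n..<real_jump_time \<omega> (Suc n)} t)"
    (is "_ = (\<Sum>n. ?f n)")
proof (cases "0 \<le> t \<and> (\<exists>n. t < real_jump_time \<omega> (Suc n))")
  case True
  then have t: "0 \<le> t" by simp
  define N where "N = (LEAST n. t < real_jump_time \<omega> (Suc n))"
  have N: "t < real_jump_time \<omega> (Suc N)"
    using True unfolding N_def
    by (intro LeastI_ex[where P = "\<lambda>n. t < real_jump_time \<omega> (Suc n)"]) (rule conjunct2)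
  have less_N: "real_jump_time \<omega> (Suc n) \<le> t" if "n < N" for n
    using not_less_Least[of n "\<lambda>n. t < real_jump_time \<omega> (Suc n)"] that unfolding N_def by simp
  have TN: "real_jump_time \<omega> N \<le> t"
  proof (cases N)
    case 0 then show ?thesis using t by (simp add: real_jump_time_def)
  next
    case (Suc m) then show ?thesis using less_N[of m] by simp
  qed
  have "growth_state \<omega> t = jump_chain \<omega> N"
    using t by (simp add: growth_state_def N_def jump_time_real ennreal_less_iff)
  then have L: "(indicator (occupation_set \<omega> G) t :: ennreal) = indicator {G} (jump_chain \<omega> N)"
    using True before_explosion_iff[OF t, of \<omega>] by (auto simp: occupation_set_def indicator_def)
  have "?f n = 0" if "n \<notin> {N}" for n
  proof -
    consider "n < N" | "N < n" using \<open>n \<notin> {N}\<close> by fastforce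
    then show ?thesis
    proof cases
      case 1 then show ?thesis using less_N[of n] by simp
    next
      case 2 then show ?thesis using N real_jump_time_mono[of "Suc N" n \<omega>] by simp
    qed
  qed
  then have "(\<Sum>n. ?f n) = (\<Sum>n\<in>{N}. ?f n)"
    by (intro suminf_finite) auto
  then show ?thesis using L N TN by simp
next
  case False
  have "?f n = 0" for n
    using False real_jump_time_nonneg[of \<omega> n] by (auto simp: indicator_def)
  then have "(\<Sum>n. ?f n) = 0" by (simp only: suminf_zero)
  moreover have "t \<notin> occupation_set \<omega> G"
    using False before_explosion_iff[of t \<omega>] by (auto simp: occupation_set_def)
  ultimately show ?thesis by (metis indicator_simps(2))
qed

lemma nn_integral_occupation_set:
  "(\<integral>\<^sup>+t. indicator (occupation_set \<omega> G) t \<partial>lborel)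
    = (\<Sum>n. indicator {G} (jump_chain \<omega> n) * ennreal (waiting_time \<omega> n))"
proof -
  have "emeasure lborel {real_jump_time \<omega> n..<real_jump_time \<omega> (Suc n)} = ennreal (waiting_time \<omega> n)" for n
  proof -
    have "real_jump_time \<omega> (Suc n) - real_jump_time \<omega> n = max 0 (waiting_time \<omega> n)"
      by (simp add: real_jump_time_def)
    then show ?thesis
      using real_jump_time_mono[of n "Suc n" \<omega>] by (simp add: ennreal_max_0)
  qed
  then show ?thesis
    unfolding indicator_occupation_set by (subst nn_integral_suminf) (auto simp: nn_integral_cmult)
qed

text \<open>Weighting by the length \<open>L\<close> and choosing a uniform fraction of \<open>[0, L)\<close> amounts to integrating
  over \<open>[0, L)\<close>. This is how size-biasing and the uniform position of time 0 combine.\<close>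

lemma nn_integral_uniform_fraction:
  fixes f :: "real \<Rightarrow> ennreal"
  assumes f [measurable]: "f \<in> borel_measurable borel" and L: "0 < L"
  shows "ennreal L * (\<integral>\<^sup>+u. f (u * L) \<partial>uniform_measure lborel {0..<1}) = (\<integral>\<^sup>+t. f t * indicator {0..<L} t \<partial>lborel)"
proof -
  have "(\<integral>\<^sup>+t. f t * indicator {0..<L} t \<partial>lborel)
      = ennreal L * (\<integral>\<^sup>+u. f (L * u) * indicator {0..<L} (L * u) \<partial>lborel)"
    using L by (subst nn_integral_real_affine[where c = L and t = 0]) auto
  also have "(\<integral>\<^sup>+u. f (L * u) * indicator {0..<L} (L * u) \<partial>lborel) = (\<integral>\<^sup>+u. f (u * L) * indicator {0..<1} u \<partial>lborel)"
    using L by (intro nn_integral_cong) (auto simp: indicator_def mult.commute zero_le_mult_iff)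
  also have "\<dots> = (\<integral>\<^sup>+u. f (u * L) \<partial>uniform_measure lborel {0..<1})"
    by (subst nn_integral_uniform_measure) (simp_all add: divide_ennreal_def)
  finally show ?thesis ..
qed

lemma stationary_process_zero:
  assumes "0 < lifetime (\<omega> 0)" "0 \<le> u" "u < 1"
  shows "stationary_process 0 (\<omega>, u) = growth_state (\<omega> 0) (u * lifetime (\<omega> 0))"
proof -
  have 0: "copy_start (\<omega>, u) 0 = - u * lifetime (\<omega> 0)" by (simp add: copy_start_def)
  have "{0..<1::int} = {0}" by auto
  then have 1: "copy_start (\<omega>, u) (0 + 1) = (1 - u) * lifetime (\<omega> 0)"
    by (simp add: copy_start_def algebra_simps)
  have le: "copy_start (\<omega>, u) 0 \<le> 0" "0 < copy_start (\<omega>, u) (0 + 1)"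
    unfolding 0 1 using assms by auto
  have "(THE i. copy_start (\<omega>, u) i \<le> 0 \<and> 0 < copy_start (\<omega>, u) (i + 1)) = 0"
    using le copy_interval_unique[of "(\<omega>, u)" _ 0 0] by (intro the_equality) auto
  then show ?thesis by (simp add: stationary_process_def 0)
qed

lemma measurable_growth_state_time: "growth_state \<omega> \<in> borel \<rightarrow>\<^sub>M count_space UNIV"
proof -
  have "(\<lambda>t. (\<omega>, t)) \<in> borel \<rightarrow>\<^sub>M path_algebra \<Otimes>\<^sub>M borel"
    by (rule measurable_Pair1') simp
  from measurable_compose[OF this measurable_growth_state] show ?thesis by simp
qed

text \<open>The renewal formula: the stationary probability of a state is the expected time spent there
  during one lifetime divided by the mean lifetime.\<close>

lemma stationary_law:
  defines "Z \<equiv> \<lambda>W. \<integral>\<^sup>+\<omega>. explosion_time \<omega> \<partial>growth_space W"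
  assumes fin: "Z W < \<infinity>" and pos: "0 < Z W"
  shows "emeasure (distr (stationary_space W) (count_space UNIV) (stationary_process 0)) {G}
    = green W G / esize G / Z W"
proof -
  let ?D = "size_biased_growth_space W" and ?U = "uniform_measure lborel {0..<1::real}"
  let ?M = "\<lambda>i::int. if i = 0 then ?D else growth_space W"
  let ?f = "\<lambda>\<omega> u. indicator {G} (growth_state \<omega> (u * lifetime \<omega>)) :: ennreal"
  have expl: "AE \<omega> in growth_space W. explosion_time \<omega> \<noteq> \<infinity>"
    using fin by (intro nn_integral_PInf_AE) (auto simp: Z_def)
  have "emeasure ?D (space ?D) = Z W / Z W"
    unfolding size_biased_growth_space_def
    by (subst emeasure_density) (auto simp: Z_def nn_integral_divide sets.top[of "growth_space W", simplified])
  also have "\<dots> = 1" using fin pos by (intro ennreal_divide_self) auto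
  finally have D: "prob_space ?D" by (rule prob_spaceI)
  have U: "prob_space ?U" by (rule prob_space_uniform_measure) auto
  have M: "prob_space (?M i)" for i using D prob_space_growth_space by simp
  interpret U: prob_space ?U by (rule U)
  interpret PM: prob_space "PiM UNIV ?M" by (intro prob_space_PiM M)
  have sp: "stationary_process 0 \<in> stationary_space W \<rightarrow>\<^sub>M count_space UNIV"
    using measurable_stationary_process measurable_cong_sets[OF sets_stationary_space refl] by blast
  have f_meas: "(\<lambda>x. ?f (fst x) (snd x)) \<in> borel_measurable (path_algebra \<Otimes>\<^sub>M borel)"
  proof -
    have "(\<lambda>x. (fst x, snd x * lifetime (fst x))) \<in> path_algebra \<Otimes>\<^sub>M borel \<rightarrow>\<^sub>M path_algebra \<Otimes>\<^sub>M borel"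
      by measurable
    from measurable_compose[OF measurable_compose[OF this measurable_growth_state], of "indicator {G}" borel]
    show ?thesis by simp
  qed
  \<comment> \<open>Size-biasing excludes a lifetime 0, the value that \<open>lifetime\<close> also has on an infinite explosion time.\<close>
  have AE_D: "AE \<omega> in ?D. 0 < lifetime \<omega>"
    unfolding size_biased_growth_space_def
  proof (subst AE_density)
    show "AE \<omega> in growth_space W. 0 < explosion_time \<omega> / (\<integral>\<^sup>+\<omega>'. explosion_time \<omega>' \<partial>growth_space W) \<longrightarrow> 0 < lifetime \<omega>"
      using expl
    proof eventually_elim
      case (elim \<omega>)
      show ?case
      proof
        assume "0 < explosion_time \<omega> / (\<integral>\<^sup>+\<omega>'. explosion_time \<omega>' \<partial>growth_space W)"
        then have "explosion_time \<omega> \<noteq> 0" by (auto simp: divide_ennreal_def)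
        then show "0 < lifetime \<omega>"
          using elim by (simp add: lifetime_def enn2real_positive_iff zero_less_iff_neq_zero top.not_eq_extremum)
      qed
    qed
  qed measurable
  have AE_M: "AE \<omega> in PiM UNIV ?M. 0 < lifetime (\<omega> 0)"
    using AE_PiM_component[of UNIV ?M 0 "\<lambda>\<omega>. 0 < lifetime \<omega>"] M AE_D by simp
  have AE_U: "AE u in ?U. 0 \<le> u \<and> u < 1"
    by (subst AE_uniform_measure) auto
  have meas_int: "(\<lambda>\<omega>. \<integral>\<^sup>+u. ?f \<omega> u \<partial>?U) \<in> borel_measurable path_algebra"
  proof -
    have "(\<lambda>x. ?f (fst x) (snd x)) \<in> borel_measurable (path_algebra \<Otimes>\<^sub>M ?U)"
      using f_meas by measurable
    from U.borel_measurable_nn_integral_fst[OF this] show ?thesis by simp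
  qed
  have sp_ind: "(\<lambda>x. indicator {G} (stationary_process 0 x) :: ennreal) \<in> borel_measurable (PiM UNIV ?M \<Otimes>\<^sub>M ?U)"
    using measurable_compose[OF sp, of "indicator {G}" borel] by (simp add: stationary_space_def)
  have "emeasure (distr (stationary_space W) (count_space UNIV) (stationary_process 0)) {G}
      = (\<integral>\<^sup>+x. indicator {G} (stationary_process 0 x) \<partial>stationary_space W)"
  proof -
    have "emeasure (distr (stationary_space W) (count_space UNIV) (stationary_process 0)) {G}
        = (\<integral>\<^sup>+y. indicator {G} y \<partial>distr (stationary_space W) (count_space UNIV) (stationary_process 0))"
      by (rule nn_integral_indicator[symmetric]) simp
    also have "\<dots> = (\<integral>\<^sup>+x. indicator {G} (stationary_process 0 x) \<partial>stationary_space W)"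
      by (rule nn_integral_distr[OF sp]) simp
    finally show ?thesis .
  qed
  also have "\<dots> = (\<integral>\<^sup>+\<omega>. \<integral>\<^sup>+u. indicator {G} (stationary_process 0 (\<omega>, u)) \<partial>?U \<partial>PiM UNIV ?M)"
    unfolding stationary_space_def by (rule U.nn_integral_fst[symmetric, OF sp_ind])
  also have "\<dots> = (\<integral>\<^sup>+\<omega>. \<integral>\<^sup>+u. ?f (\<omega> 0) u \<partial>?U \<partial>PiM UNIV ?M)"
  proof (rule nn_integral_cong_AE)
    show "AE \<omega> in PiM UNIV ?M. (\<integral>\<^sup>+u. indicator {G} (stationary_process 0 (\<omega>, u)) \<partial>?U) = (\<integral>\<^sup>+u. ?f (\<omega> 0) u \<partial>?U)"
      using AE_M
    proof eventually_elim
      case (elim \<omega>)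
      show ?case
        by (rule nn_integral_cong_AE, use AE_U in eventually_elim) (simp add: stationary_process_zero elim)
    qed
  qed
  also have "\<dots> = (\<integral>\<^sup>+\<omega>. \<integral>\<^sup>+u. ?f \<omega> u \<partial>?U \<partial>distr (PiM UNIV ?M) ?D (\<lambda>\<omega>. \<omega> 0))"
  proof (rule nn_integral_distr[symmetric])
    show "(\<lambda>\<omega>. \<omega> 0) \<in> PiM UNIV ?M \<rightarrow>\<^sub>M ?D"
      using measurable_component_singleton[of 0 UNIV ?M] by simp
    show "(\<lambda>\<omega>. \<integral>\<^sup>+u. ?f \<omega> u \<partial>?U) \<in> borel_measurable (distr (PiM UNIV ?M) ?D (\<lambda>\<omega>. \<omega> 0))"
      using meas_int measurable_cong_sets[OF sets_size_biased refl] by auto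
  qed
  \<comment> \<open>Only the copy whose interval contains time 0 matters from here on.\<close>
  also have "distr (PiM UNIV ?M) ?D (\<lambda>\<omega>. \<omega> 0) = ?D"
    using distr_PiM_component[of UNIV ?M 0] M by simp
  also have "(\<integral>\<^sup>+\<omega>. \<integral>\<^sup>+u. ?f \<omega> u \<partial>?U \<partial>?D)
      = (\<integral>\<^sup>+\<omega>. explosion_time \<omega> / Z W * (\<integral>\<^sup>+u. ?f \<omega> u \<partial>?U) \<partial>growth_space W)"
  proof -
    have m1: "explosion_time \<in> borel_measurable (growth_space W)" by measurable
    have m2: "(\<lambda>\<omega>. \<integral>\<^sup>+u. ?f \<omega> u \<partial>?U) \<in> borel_measurable (growth_space W)"
      using meas_int measurable_cong_sets[OF sets_growth_space refl] by auto
    show ?thesis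
      unfolding size_biased_growth_space_def Z_def using m1 by (intro nn_integral_density m2) measurable
  qed
  also have "\<dots> = (\<integral>\<^sup>+\<omega>. (\<Sum>n. indicator {G} (jump_chain \<omega> n) * ennreal (waiting_time \<omega> n)) / Z W \<partial>growth_space W)"
  proof (rule nn_integral_cong_AE)
    show "AE \<omega> in growth_space W. explosion_time \<omega> / Z W * (\<integral>\<^sup>+u. ?f \<omega> u \<partial>?U)
        = (\<Sum>n. indicator {G} (jump_chain \<omega> n) * ennreal (waiting_time \<omega> n)) / Z W"
      using expl
    proof eventually_elim
      case (elim \<omega>)
      have "explosion_time \<omega> * (\<integral>\<^sup>+u. ?f \<omega> u \<partial>?U)
          = (\<Sum>n. indicator {G} (jump_chain \<omega> n) * ennreal (waiting_time \<omega> n))"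
      proof (cases "explosion_time \<omega> = 0")
        case True
        then have "ennreal (waiting_time \<omega> n) = 0" for n
          using sum_le_suminf[of "\<lambda>n. ennreal (waiting_time \<omega> n)" "{n}"]
          by (simp add: explosion_time_eq_suminf)
        then show ?thesis using True by simp
      next
        case False
        define L where "L = lifetime \<omega>"
        have L: "0 < L" "explosion_time \<omega> = ennreal L"
          using elim False unfolding L_def
          by (simp_all add: lifetime_def enn2real_positive_iff zero_less_iff_neq_zero top.not_eq_extremum)
        have g: "(\<lambda>t. indicator {G} (growth_state \<omega> t) :: ennreal) \<in> borel_measurable borel"
          using measurable_compose[OF measurable_growth_state_time, of "indicator {G}" borel] by simp
        have "explosion_time \<omega> * (\<integral>\<^sup>+u. ?f \<omega> u \<partial>?U)
            = (\<integral>\<^sup>+t. indicator {G} (growth_state \<omega> t) * indicator {0..<L} t \<partial>lborel)"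
          unfolding L(2) L_def[symmetric] by (rule nn_integral_uniform_fraction[OF g L(1)])
        also have "\<dots> = (\<integral>\<^sup>+t. indicator (occupation_set \<omega> G) t \<partial>lborel)"
          by (intro nn_integral_cong) (auto simp: occupation_set_def indicator_def L(2) ennreal_less_iff)
        finally show ?thesis by (simp only: nn_integral_occupation_set)
      qed
      then show ?case by (simp only: ennreal_divide_times ennreal_times_divide)
    qed
  qed
  also have "\<dots> = green W G / esize G / Z W"
    by (subst nn_integral_divide) (auto simp: nn_integral_sojourn)
  finally show ?thesis .
qed

lemma mean_explosion_time_pos: "0 < (\<integral>\<^sup>+\<omega>. explosion_time \<omega> \<partial>growth_space W)"
proof -
  have "0 < green W singleton_rgraph / esize singleton_rgraph"
    unfolding green_rec[of W singleton_rgraph] by (simp add: esize_singleton divide_ennreal_def add_pos_nonneg)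
  also have "\<dots> = (\<integral>\<^sup>+G. green W G / esize G * indicator {singleton_rgraph} G \<partial>count_space UNIV)"
    by simp
  also have "\<dots> \<le> (\<integral>\<^sup>+\<omega>. explosion_time \<omega> \<partial>growth_space W)"
    unfolding nn_integral_explosion_time by (intro nn_integral_mono) (auto simp: indicator_def)
  finally show ?thesis .
qed

lemma is_steady_state_law_iff:
  defines "Z \<equiv> \<lambda>W. \<integral>\<^sup>+\<omega>. explosion_time \<omega> \<partial>growth_space W"
  shows "is_steady_state_law W \<longleftrightarrow> Z W < \<infinity> \<and> (\<forall>G. pmf W G = green W G / esize G / Z W)"
proof (cases "Z W < \<infinity>")
  case True
  then have "AE \<omega> in growth_space W. explosion_time \<omega> \<noteq> \<infinity>"
    by (intro nn_integral_PInf_AE) (auto simp: Z_def)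
  then have AE: "AE \<omega> in growth_space W. explosion_time \<omega> < \<infinity>"
    by (simp add: top.not_eq_extremum)
  let ?L = "distr (stationary_space W) (count_space UNIV) (stationary_process 0)"
  have "?L = measure_pmf W \<longleftrightarrow> (\<forall>G. emeasure ?L {G} = emeasure (measure_pmf W) {G})"
    by (auto intro: measure_eqI_countable[of _ UNIV])
  also have "\<dots> \<longleftrightarrow> (\<forall>G. pmf W G = green W G / esize G / Z W)"
    using stationary_law[of W] True mean_explosion_time_pos[of W]
    by (auto simp: Z_def emeasure_pmf_single)
  finally show ?thesis using True AE by (simp add: is_steady_state_law_def Z_def)
qed (simp add: is_steady_state_law_def Z_def)

lemma esize_mult_inverse: "esize G * (inverse (esize G) * a) = a"
  using esize_divide_self[of G] by (simp only: divide_ennreal_def mult.assoc[symmetric] mult_1_left)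

text \<open>If \<open>W\<close> is its own stationary law, then the Green function is a multiple of \<open>|G| W(G)\<close>, and its
  recursion becomes the balance equation.\<close>

lemma steady_imp_balanced:
  assumes "is_steady_state_law W"
  shows "balanced (1 / 2) W"
proof -
  define Z where "Z = (\<integral>\<^sup>+\<omega>. explosion_time \<omega> \<partial>growth_space W)"
  have W: "ennreal (pmf W G) = green W G / esize G / Z" for G
    using assms by (auto simp: is_steady_state_law_iff Z_def)
  have e: "esize G * pmf W G = green W G / Z" for G
  proof -
    have "esize G * pmf W G = esize G * (inverse (esize G) * (green W G * inverse Z))"
      unfolding W by (simp add: divide_ennreal_def mult_ac)
    then show ?thesis by (simp only: esize_mult_inverse divide_ennreal_def)
  qed
  have "balanced (1 / Z) W"
    unfolding balanced_def
  proof
    fix K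
    have "(\<integral>\<^sup>+G. esize G * pmf (attach_law W G) K \<partial>measure_pmf W)
        = (\<integral>\<^sup>+G. (esize G * pmf W G) * pmf (attach_law W G) K \<partial>count_space UNIV)"
      by (simp add: nn_integral_measure_pmf mult_ac)
    also have "\<dots> = (\<integral>\<^sup>+G. green W G * pmf (attach_law W G) K \<partial>count_space UNIV) / Z"
      by (simp add: e divide_ennreal_def mult_ac nn_integral_cmult)
    finally show "esize K * pmf W K = 1 / Z * indicator {singleton_rgraph} K
        + (\<integral>\<^sup>+G. esize G * pmf (attach_law W G) K \<partial>measure_pmf W)"
      unfolding e by (subst green_rec) (simp add: divide_ennreal_def mult_ac distrib_left)
  qed
  then show ?thesis using balanced_const by metis
qed

text \<open>Attaching a graph increases the size, so the recursion of the Green function determines it by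
  induction over the size.\<close>

lemma green_unique:
  fixes g :: "rgraph \<Rightarrow> ennreal"
  assumes "\<And>K. g K = indicator {singleton_rgraph} K + (\<integral>\<^sup>+G. g G * pmf (attach_law W G) K \<partial>count_space UNIV)"
  shows "g K = green W K"
proof (induction "num_verts K" arbitrary: K rule: less_induct)
  case less
  have "g G * pmf (attach_law W G) K = green W G * pmf (attach_law W G) K" for G
  proof (cases "K \<in> set_pmf (attach_law W G)")
    case True
    then obtain C where "K \<in> set_pmf (attach_uniform G C)" by (auto simp: attach_law_def)
    then have "num_verts G < num_verts K"
      using num_verts_attach_uniform num_verts_pos[of C] by fastforce
    then show ?thesis using less by simp
  qed (simp add: set_pmf_iff)
  then show ?case by (subst assms, subst green_rec) simp
qed

text \<open>By the balance equation \<open>2 |K| W(K)\<close> satisfies the recursion of the Green function. Hence the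
  expected time spent in \<open>K\<close> is \<open>2 W(K)\<close>, the mean lifetime is 2, and the ratio is
  \<open>W(K)\<close>.\<close>

lemma balanced_imp_steady:
  assumes b: "balanced (1 / 2) W"
  shows "is_steady_state_law W"
proof -
  have green: "2 * (esize K * pmf W K) = green W K" for K
  proof (rule green_unique)
    fix K
    have "2 * (esize K * pmf W K) = (2 * (1 / 2)) * indicator {singleton_rgraph} K
        + 2 * (\<integral>\<^sup>+G. esize G * pmf (attach_law W G) K \<partial>measure_pmf W)"
      using b by (simp only: balanced_def distrib_left mult.assoc)
    also have "(2 * (1 / 2) :: ennreal) = 1"
      using ennreal_half_times_2 by (simp only: mult.commute)
    also have "2 * (\<integral>\<^sup>+G. esize G * pmf (attach_law W G) K \<partial>measure_pmf W)
        = (\<integral>\<^sup>+G. 2 * (esize G * pmf W G) * pmf (attach_law W G) K \<partial>count_space UNIV)"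
      by (simp add: nn_integral_measure_pmf nn_integral_cmult[symmetric] mult_ac)
    finally show "2 * (esize K * pmf W K) = indicator {singleton_rgraph} K
        + (\<integral>\<^sup>+G. 2 * (esize G * pmf W G) * pmf (attach_law W G) K \<partial>count_space UNIV)"
      by simp
  qed
  have occ: "green W K / esize K = 2 * ennreal (pmf W K)" for K
    unfolding green[symmetric] by (simp add: divide_ennreal_def mult_ac esize_mult_inverse)
  have "(\<integral>\<^sup>+\<omega>. explosion_time \<omega> \<partial>growth_space W) = 2"
    by (simp add: nn_integral_explosion_time occ nn_integral_cmult nn_integral_pmf)
  moreover have "ennreal (pmf W G) = 2 * ennreal (pmf W G) / 2" for G
    by (subst mult.commute) (simp add: ennreal_mult_divide_eq)
  ultimately show ?thesis
    by (simp add: is_steady_state_law_iff occ)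
qed

section \<open>The steady state law solves the recursive equation\<close>

theorem corollary5:
  shows "is_tree_law steady_state_law \<and> satisfies_rde steady_state_law \<and>
    (\<forall>W. is_tree_law W \<and> satisfies_rde W \<longrightarrow> W = steady_state_law)"
proof -
  obtain V where V: "satisfies_rde V"
    using rde_solution_exists by blast
  have unique: "W = V" if "balanced (1 / 2) W" for W
    using balanced_unique[OF that rde_imp_balanced[OF V]] .
  have "steady_state_law = V"
    unfolding steady_state_law_def
    using balanced_imp_steady[OF rde_imp_balanced[OF V]] steady_imp_balanced unique
    by (intro the_equality) auto
  then show ?thesis
    using V rde_is_tree_law[OF V] rde_imp_balanced unique by auto
qed

end
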